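(* For every Euclidean zero-set $\widetilde{\mathcal Z}$ with finite area, $$\lim_{\alpha\to1^-}\frac{\widetilde I(\alpha,0,\widetilde{\mathcal Z})}{1-\alpha}=\mathrm{area}(\widetilde{\mathcal Z}),\qquad \lim_{\alpha\to1^-}\frac{\widetilde I(\alpha,\alpha,\widetilde{\mathcal Z})}{1-\alpha}=\widetilde\gamma_{\rm thin}(\widetilde{\mathcal Z}).$$ Moreover, with the supremum over Euclidean zero-sets $\widetilde{\mathcal Z}$ with finite positive area, $$\sup_{\widetilde{\mathcal Z}}\frac{\widetilde I(\alpha,\alpha,\widetilde{\mathcal Z})}{\widetilde\gamma(\widetilde{\mathcal Z})}=\begin{cases}1+o(\alpha),&\alpha\to0^+,\\ 2(1-\alpha)+o(1-\alpha),&\alpha\to1^-.\end{cases}$$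
   Context: $\widetilde R_{a,b}=[0,a]\times[0,b]$. A Euclidean zero-set is a closed $\widetilde{\mathcal Z}\subseteq[0,\infty)^2$ such that $(a,b)\in\widetilde{\mathcal Z}$ implies $\widetilde R_{a,b}\subseteq\widetilde{\mathcal Z}$, and $\widetilde{\mathcal Z}$ is the closure of $\widetilde{\mathcal Z}\cap(0,\infty)^2$. For Borel $A\subseteq[0,\infty)^2$, $\widetilde{\mathrm{row}}(x,A)$ (resp. $\widetilde{\mathrm{col}}(x,A)$) is the 1-dimensional Lebesgue measure of $A$ intersected with the horizontal (resp. vertical) line through $x$. For left-continuous nonincreasing $f,g:[0,\infty)\to[0,\infty)$ of compact support, $\widetilde{\mathcal T}(A)=A\cup\{(u,v):(\widetilde{\mathrm{row}}((u,v),A)+f(v),\widetilde{\mathrm{col}}((u,v),A)+g(u))\notin\widetilde{\mathcal Z}\}$; $A$ E-spans for $(\widetilde{\mathcal Z},f,g)$ if $\bigcup_n\widetilde{\mathcal T}^n(A)=[0,\infty)^2$. For bounded $\widetilde{\mathcal Z}$ and $(\alpha,\beta)\in[0,1]^2$: $\widetilde I(\alpha,\beta,\widetilde{\mathcal Z})=\inf\{\mathrm{area}(A)+(1-\alpha)\int_0^\infty f+(1-\beta)\int_0^\infty g\}$ over all $(A,f,g)$ with $A$ compact E-spanning for $(\widetilde{\mathcal Z},f,g)$; $\widetilde\gamma_{\rm thin}(\widetilde{\mathcal Z})=\inf\{\int f+\int g:\emptyset\text{ E-spans for }(\widetilde{\mathcal Z},f,g)\}$. For general $\widetilde{\mathcal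 Z}$ both are defined as $\lim_{R\to\infty}$ of the values for $\widetilde{\mathcal Z}\cap[0,R]^2$. $\widetilde\gamma(\widetilde{\mathcal Z})=\widetilde I(0,0,\widetilde{\mathcal Z})$. *)

theory Defs
  imports "HOL-Analysis.Analysis"
begin

definition quadrant :: "(real \<times> real) set" where
  "quadrant = {0..} \<times> {0..}"

definition euclid_zero_set :: "(real \<times> real) set \<Rightarrow> bool" where
  "euclid_zero_set Z \<longleftrightarrow>
     closed Z \<and> Z \<subseteq> quadrant \<and>
     (\<forall>a b. (a, b) \<in> Z \<longrightarrow> {0..a} \<times> {0..b} \<subseteq> Z) \<and>
     Z = closure (Z \<inter> ({0<..} \<times> {0<..}))"

definition erow :: "real \<times> real \<Rightarrow> (real \<times> real) set \<Rightarrow> ennreal" where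
  "erow p A = emeasure lebesgue {t. (t, snd p) \<in> A}"

definition ecol :: "real \<times> real \<Rightarrow> (real \<times> real) set \<Rightarrow> ennreal" where
  "ecol p A = emeasure lebesgue {s. (fst p, s) \<in> A}"

definition in_zs :: "ennreal \<times> ennreal \<Rightarrow> (real \<times> real) set \<Rightarrow> bool" where
  "in_zs x Z \<longleftrightarrow> fst x \<noteq> \<infinity> \<and> snd x \<noteq> \<infinity> \<and> (enn2real (fst x), enn2real (snd x)) \<in> Z"

definition adm_fun :: "(real \<Rightarrow> real) \<Rightarrow> bool" where
  "adm_fun f \<longleftrightarrow>
     (\<forall>x\<ge>0. f x \<ge> 0) \<and>
     (\<forall>x y. 0 \<le> x \<longrightarrow> x \<le> y \<longrightarrow> f y \<le> f x) \<and>
     (\<forall>x>0. (f \<longlongrightarrow> f x) (at_left x)) \<and>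
     (\<exists>R. \<forall>x\<ge>R. f x = 0)"

definition ET :: "(real \<times> real) set \<Rightarrow> (real \<Rightarrow> real) \<Rightarrow> (real \<Rightarrow> real)
                   \<Rightarrow> (real \<times> real) set \<Rightarrow> (real \<times> real) set" where
  "ET Z f g A = A \<union> {(u, v). u \<ge> 0 \<and> v \<ge> 0 \<and>
      \<not> in_zs (erow (u, v) A + ennreal (f v), ecol (u, v) A + ennreal (g u)) Z}"

definition Espans :: "(real \<times> real) set \<Rightarrow> (real \<Rightarrow> real) \<Rightarrow> (real \<Rightarrow> real)
                        \<Rightarrow> (real \<times> real) set \<Rightarrow> bool" where
  "Espans Z f g A \<longleftrightarrow> (\<Union>n. (ET Z f g ^^ n) A) = quadrant"

definition I_bdd :: "real \<Rightarrow> real \<Rightarrow> (real \<times> real) set \<Rightarrow> real" where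
  "I_bdd \<alpha> \<beta> Z = Inf {measure lebesgue A + (1 - \<alpha>) * integral {0..} f + (1 - \<beta>) * integral {0..} g
       | A f g. compact A \<and> adm_fun f \<and> adm_fun g \<and> Espans Z f g A}"

definition gthin_bdd :: "(real \<times> real) set \<Rightarrow> real" where
  "gthin_bdd Z = Inf {integral {0..} f + integral {0..} g
       | f g. adm_fun f \<and> adm_fun g \<and> Espans Z f g {}}"

definition Itilde :: "real \<Rightarrow> real \<Rightarrow> (real \<times> real) set \<Rightarrow> ereal" where
  "Itilde \<alpha> \<beta> Z = Lim at_top (\<lambda>R. ereal (I_bdd \<alpha> \<beta> (Z \<inter> ({0..R} \<times> {0..R}))))"

definition gamma_thin :: "(real \<times> real) set \<Rightarrow> ereal" where
  "gamma_thin Z = Lim at_top (\<lambda>R. ereal (gthin_bdd (Z \<inter> ({0..R} \<times> {0..R}))))"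

definition gamma_tilde :: "(real \<times> real) set \<Rightarrow> ereal" where
  "gamma_tilde Z = Itilde 0 0 Z"

end

theory Submission
  imports Defs
begin

text \<open>
  If \<open>A\<close> spans with enhancements \<open>f\<close>, \<open>g\<close>, then the empty set spans with the decreasing
  rearrangements of $f + \mathrm{row}\,A$ and $g + \mathrm{col}\,A$. Hence
  $\gamma_{\rm thin} \le 2\,\mathrm{area}(A) + \int f + \int g$, and splitting the cost as
  $a + (1-\alpha)T = (1-2\alpha)(a+T) + \alpha(2a+T)$ gives
  $I(\alpha,\alpha) \ge (1-2\alpha)\gamma + \alpha\gamma_{\rm thin}$ for $\alpha \le 1/2$ and
  $I(\alpha,\alpha) = (1-\alpha)\gamma_{\rm thin}$ for $\alpha \ge 1/2$.
  For an L-shape with arms of length \<open>n\<close> and width 1, $\gamma \le n$ (a block-diagonal set) while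
  $\gamma_{\rm thin} \ge 2n - 2$, so the supremum of the ratios is exactly
  $\min(1, 2(1-\alpha))$.

  The lower bounds on thin spanning come from a barrier: if
  $(x + f(y), y + g(x)) \in Z$, growth from the empty set never enters
  $[x,\infty) \times [y,\infty)$. When $\int g$ is small, \<open>g\<close> is small away from a thin strip, and the
  barrier forces \<open>f\<close> to dominate the boundary of \<open>Z\<close> up to a small shift.
\<close>

text \<open>Area is priced at 1 and each enhancement at \<open>1 - \<alpha>\<close>. Absorbing
  \<open>A\<close> charges its area once to \<open>f\<close> and once to \<open>g\<close>, so
  thinning changes the price of area from 1 to \<open>2 * (1 - \<alpha>)\<close>; the threshold
  \<open>\<alpha> = 1/2\<close> and the factor 2 both come from this. L-shapes show that the
  doubling is sharp: one diagonal block serves both arms, whereas thin growth has to pay for each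
  arm separately. Rearranging is forced by admissibility, since an enhancement plus row lengths is
  in general neither monotone nor left-continuous. It moves points around, however, so the two
  growths cannot be compared by inclusion, only through ranks. In the limit of
  \<open>Itilde \<alpha> 0 Z / (1 - \<alpha>)\<close> the lower bound for a set inside a box of side
  \<open>R\<close> carries an error of order \<open>(1 - \<alpha>) * R^2\<close>, which is not
  uniform in \<open>R\<close>. Monotonicity in \<open>R\<close> turns the limit over truncations
  into a supremum, so \<open>R\<close> can be fixed before \<open>\<alpha>\<close> tends to
  1.\<close>

section \<open>Lower sets, the growth dynamics and the barrier\<close>

definition lower_set :: "(real \<times> real) set \<Rightarrow> bool" where
  "lower_set B \<longleftrightarrow> B \<subseteq> quadrant \<and> (\<forall>a b. (a, b) \<in> B \<longrightarrow> {0..a} \<times> {0..b} \<subseteq> B)"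

lemma lower_setD:
  assumes "lower_set B" "(a, b) \<in> B" "0 \<le> x" "x \<le> a" "0 \<le> y" "y \<le> b"
  shows "(x, y) \<in> B"
  using assms unfolding lower_set_def by force

lemma lower_set_nonneg:
  assumes "lower_set B" "(a, b) \<in> B"
  shows "0 \<le> a" "0 \<le> b"
  using assms unfolding lower_set_def quadrant_def by auto

text \<open>The sections are intervals, so growth from \<open>{}\<close> has measurable rows and
  columns without any planar measurability argument.\<close>

lemma lower_set_sections_borel:
  assumes "lower_set B"
  shows "{t. (t, v) \<in> B} \<in> sets borel" "{s. (u, s) \<in> B} \<in> sets borel"
proof -
  have "is_interval {t. (t, v) \<in> B}"
    unfolding is_interval_1
    using lower_setD[OF assms] lower_set_nonneg[OF assms] by (smt (verit) mem_Collect_eq)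
  then show "{t. (t, v) \<in> B} \<in> sets borel" by (rule real_interval_borel_measurable)
  have "is_interval {s. (u, s) \<in> B}"
    unfolding is_interval_1
    using lower_setD[OF assms] lower_set_nonneg[OF assms] by (smt (verit) mem_Collect_eq)
  then show "{s. (u, s) \<in> B} \<in> sets borel" by (rule real_interval_borel_measurable)
qed

lemma emeasure_lebesgue_borel:
  fixes X :: "'a::euclidean_space set"
  assumes "X \<in> sets borel"
  shows "emeasure lebesgue X = emeasure lborel X"
  using assms by simp

text \<open>Finiteness is built into \<open>in_zs\<close> because \<open>enn2real\<close> reads
  \<open>\<infinity>\<close> as 0, which would otherwise break this monotonicity.\<close>

lemma in_zs_mono:
  assumes "lower_set Z" "in_zs (x, y) Z" "x' \<le> x" "y' \<le> y"
  shows "in_zs (x', y') Z"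
proof -
  have fin: "x < top" "y < top" and Z: "(enn2real x, enn2real y) \<in> Z"
    using assms(2) by (auto simp: in_zs_def top.not_eq_extremum)
  have fin': "x' < top" "y' < top"
    using fin assms(3,4) by auto
  have "enn2real x' \<le> enn2real x" "enn2real y' \<le> enn2real y"
    using fin assms(3,4) by (auto intro: enn2real_mono)
  then have "(enn2real x', enn2real y') \<in> Z"
    using lower_setD[OF assms(1) Z] by simp
  then show ?thesis using fin' by (auto simp: in_zs_def)
qed

lemma in_zs_ennreal:
  assumes "0 \<le> x" "0 \<le> y"
  shows "in_zs (ennreal x, ennreal y) Z \<longleftrightarrow> (x, y) \<in> Z"
  using assms by (simp add: in_zs_def)

lemma ET_iff:
  "(u, v) \<in> ET Z f g A \<longleftrightarrow> (u, v) \<in> A \<or> 0 \<le> u \<and> 0 \<le> v \<and>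
     \<not> in_zs (erow (u, v) A + ennreal (f v), ecol (u, v) A + ennreal (g u)) Z"
  by (simp add: ET_def)

lemma ET_iter_nonneg:
  assumes "(u, v) \<in> (ET Z f g ^^ n) A" "A \<subseteq> quadrant"
  shows "0 \<le> u" "0 \<le> v"
proof -
  have "(ET Z f g ^^ n) A \<subseteq> quadrant"
    by (induction n) (use assms(2) in \<open>auto simp: ET_def quadrant_def\<close>)
  then show "0 \<le> u" "0 \<le> v" using assms(1) by (auto simp: quadrant_def)
qed

text \<open>Moving towards the origin lengthens the row and column sections of a lower set and
  increases \<open>f\<close> and \<open>g\<close>, so a point that is added brings everything below
  and to the left of it.\<close>

lemma lower_set_ET:
  assumes Z: "lower_set Z" and B: "lower_set B"
    and f: "\<And>x y. 0 \<le> x \<Longrightarrow> x \<le> y \<Longrightarrow> f y \<le> f x"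
    and g: "\<And>x y. 0 \<le> x \<Longrightarrow> x \<le> y \<Longrightarrow> g y \<le> g x"
  shows "lower_set (ET Z f g B)"
  unfolding lower_set_def
proof (intro conjI allI impI subsetI)
  fix p assume "p \<in> ET Z f g B"
  then show "p \<in> quadrant"
    using B by (auto simp: ET_def lower_set_def quadrant_def)
next
  fix a b p assume ab: "(a, b) \<in> ET Z f g B" and p: "p \<in> {0..a} \<times> {0..b}"
  obtain x y where xy: "p = (x, y)" "0 \<le> x" "x \<le> a" "0 \<le> y" "y \<le> b" using p by auto
  show "p \<in> ET Z f g B"
  proof (cases "(a, b) \<in> B")
    case True
    then show ?thesis using lower_setD[OF B True] xy by (auto simp: ET_def)
  next
    case False
    then have *: "\<not> in_zs (erow (a, b) B + ennreal (f b), ecol (a, b) B + ennreal (g a)) Z"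
      using ab by (auto simp: ET_def)
    have r: "erow (a, b) B \<le> erow (x, y) B"
      unfolding erow_def
    proof (rule emeasure_mono)
      show "{t. (t, snd (a, b)) \<in> B} \<subseteq> {t. (t, snd (x, y)) \<in> B}"
        using xy by (auto intro: lower_setD[OF B] dest: lower_set_nonneg[OF B])
    qed (use lower_set_sections_borel[OF B] in auto)
    have c: "ecol (a, b) B \<le> ecol (x, y) B"
      unfolding ecol_def
    proof (rule emeasure_mono)
      show "{s. (fst (a, b), s) \<in> B} \<subseteq> {s. (fst (x, y), s) \<in> B}"
        using xy by (auto intro: lower_setD[OF B] dest: lower_set_nonneg[OF B])
    qed (use lower_set_sections_borel[OF B] in auto)
    have "\<not> in_zs (erow (x, y) B + ennreal (f y), ecol (x, y) B + ennreal (g x)) Z"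
      using * in_zs_mono[OF Z] add_mono[OF r ennreal_leI[OF f]] add_mono[OF c ennreal_leI[OF g]] xy
      by blast
    then show ?thesis using xy by (auto simp: ET_def)
  qed
qed

lemma lower_set_ET_iter:
  assumes "lower_set Z"
    and "\<And>x y. 0 \<le> x \<Longrightarrow> x \<le> y \<Longrightarrow> f y \<le> f x"
    and "\<And>x y. 0 \<le> x \<Longrightarrow> x \<le> y \<Longrightarrow> g y \<le> g x"
  shows "lower_set ((ET Z f g ^^ n) {})"
proof (induction n)
  case 0
  then show ?case by (simp add: lower_set_def)
next
  case (Suc n)
  then show ?case using lower_set_ET[OF assms(1) Suc assms(2,3)] by simp
qed

text \<open>A point $(u,v)$ with $u \ge x$, $v \ge y$ only sees the strips $[0,x)$ and $[0,y)$,
  so $[x,\infty) \times [y,\infty)$ is never entered if the pair below lies in the zero-set.\<close>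

lemma Espans_empty_barrier:
  assumes Z: "lower_set Z" and sp: "Espans Z f g {}"
    and f: "\<And>x y. 0 \<le> x \<Longrightarrow> x \<le> y \<Longrightarrow> f y \<le> f x" "\<And>x. 0 \<le> x \<Longrightarrow> 0 \<le> f x"
    and g: "\<And>x y. 0 \<le> x \<Longrightarrow> x \<le> y \<Longrightarrow> g y \<le> g x" "\<And>x. 0 \<le> x \<Longrightarrow> 0 \<le> g x"
    and xy: "0 \<le> x" "0 \<le> y"
  shows "(x + f y, y + g x) \<notin> Z"
proof
  assume in_Z: "(x + f y, y + g x) \<in> Z"
  have avoid: "(u, v) \<notin> (ET Z f g ^^ n) {}" if "x \<le> u" "y \<le> v" for n u v
    using that
  proof (induction n arbitrary: u v)
    case (Suc n)
    let ?B = "(ET Z f g ^^ n) {}"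
    have "{t. (t, v) \<in> ?B} \<subseteq> {0..x}"
    proof
      fix t assume "t \<in> {t. (t, v) \<in> ?B}"
      then show "t \<in> {0..x}"
        using Suc.IH[of t v] Suc.prems ET_iter_nonneg(1)[of t v n Z f g "{}"] by (cases "x \<le> t") auto
    qed
    then have "erow (u, v) ?B \<le> emeasure lebesgue {0..x}"
      unfolding erow_def by (intro emeasure_mono) auto
    then have r: "erow (u, v) ?B \<le> ennreal x" using xy by simp
    have "{s. (u, s) \<in> ?B} \<subseteq> {0..y}"
    proof
      fix s assume "s \<in> {s. (u, s) \<in> ?B}"
      then show "s \<in> {0..y}"
        using Suc.IH[of u s] Suc.prems ET_iter_nonneg(2)[of u s n Z f g "{}"] by (cases "y \<le> s") auto
    qed
    then have "ecol (u, v) ?B \<le> emeasure lebesgue {0..y}"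
      unfolding ecol_def by (intro emeasure_mono) auto
    then have c: "ecol (u, v) ?B \<le> ennreal y" using xy by simp
    have "erow (u, v) ?B + ennreal (f v) \<le> ennreal (x + f y)"
      using add_mono[OF r ennreal_leI[OF f(1)[OF xy(2) Suc.prems(2)]]] xy f(2) by simp
    moreover have "ecol (u, v) ?B + ennreal (g u) \<le> ennreal (y + g x)"
      using add_mono[OF c ennreal_leI[OF g(1)[OF xy(1) Suc.prems(1)]]] xy g(2) by simp
    moreover have "in_zs (ennreal (x + f y), ennreal (y + g x)) Z"
      using in_Z xy f(2) g(2) by (subst in_zs_ennreal) auto
    ultimately have "in_zs (erow (u, v) ?B + ennreal (f v), ecol (u, v) ?B + ennreal (g u)) Z"
      using in_zs_mono[OF Z] by blast
    then show ?case using Suc by (simp add: ET_iff)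
  qed simp
  have "(x, y) \<in> (\<Union>n. (ET Z f g ^^ n) {})"
    using sp xy by (auto simp: Espans_def quadrant_def)
  then show False using avoid[of x y] by auto
qed

section \<open>Decreasing rearrangement\<close>

definition suplevel :: "(real \<Rightarrow> real) \<Rightarrow> real \<Rightarrow> real set" where
  "suplevel H c = {x. 0 \<le> x \<and> c \<le> H x}"

text \<open>The generalised inverse of the distribution function of \<open>H\<close>. The weak
  inequality on measures makes it left-continuous. For \<open>s \<le> 0\<close> every level
  qualifies, so the cap \<open>K\<close> keeps the supremum finite and is the value there; level 0
  always qualifies, since \<open>suplevel H 0\<close> is the whole half-line for a
  \<open>bump\<close>.\<close>

definition rearr :: "real \<Rightarrow> (real \<Rightarrow> real) \<Rightarrow> real \<Rightarrow> real" where
  "rearr K H s = Sup {c. 0 \<le> c \<and> c \<le> K \<and> ennreal s \<le> emeasure lborel (suplevel H c)}"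

definition bump :: "real \<Rightarrow> real \<Rightarrow> (real \<Rightarrow> real) \<Rightarrow> bool" where
  "bump R K H \<longleftrightarrow> 0 \<le> R \<and> H \<in> borel_measurable borel \<and>
     (\<forall>x\<ge>0. 0 \<le> H x \<and> H x \<le> K) \<and> (\<forall>x>R. H x = 0)"

definition half_line_integral :: "(real \<Rightarrow> real) \<Rightarrow> ennreal" where
  "half_line_integral H = (\<integral>\<^sup>+x\<in>{0..}. ennreal (H x) \<partial>lborel)"

lemma suplevel_borel [measurable]:
  assumes [measurable]: "H \<in> borel_measurable borel"
  shows "suplevel H c \<in> sets borel"
  unfolding suplevel_def by measurable

lemma suplevel_antimono: "c \<le> d \<Longrightarrow> suplevel H d \<subseteq> suplevel H c"
  by (auto simp: suplevel_def)

lemma emeasure_suplevel_antimono: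
  assumes "H \<in> borel_measurable borel" "c \<le> d"
  shows "emeasure lborel (suplevel H d) \<le> emeasure lborel (suplevel H c)"
  using assms by (intro emeasure_mono suplevel_antimono) auto

lemma emeasure_half_line: "emeasure lborel {0::real..} = \<infinity>"
proof -
  have "ennreal (of_nat n) \<le> emeasure lborel {0::real..}" for n :: nat
  proof -
    have "emeasure lborel {0..real n} \<le> emeasure lborel {0::real..}"
      by (intro emeasure_mono) auto
    then show ?thesis by simp
  qed
  then show ?thesis
    by (metis ennreal_SUP_of_nat_eq_top SUP_least top.extremum_unique ennreal_of_nat_eq_real_of_nat
        infinity_ennreal_def)
qed

context
  fixes R K :: real and H :: "real \<Rightarrow> real"
  assumes bump: "bump R K H"
begin

lemma bump_meas: "H \<in> borel_measurable borel"
  using bump by (simp add: bump_def)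

lemma bump_bounds: "0 \<le> x \<Longrightarrow> 0 \<le> H x" "0 \<le> x \<Longrightarrow> H x \<le> K" "0 \<le> K" "0 \<le> R"
proof -
  show "0 \<le> x \<Longrightarrow> 0 \<le> H x" "0 \<le> x \<Longrightarrow> H x \<le> K" "0 \<le> R" using bump by (auto simp: bump_def)
  have "0 \<le> H 0" "H 0 \<le> K" using bump unfolding bump_def by blast+
  then show "0 \<le> K" by simp
qed

lemma bump_eq_0: "R < x \<Longrightarrow> H x = 0"
  using bump unfolding bump_def by blast

lemma suplevel_zero: "suplevel H 0 = {0..}"
  using bump_bounds by (auto simp: suplevel_def)

lemma rearr_set_nonempty:
  "0 \<in> {c. 0 \<le> c \<and> c \<le> K \<and> ennreal s \<le> emeasure lborel (suplevel H c)}"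
  using bump_bounds by (simp add: suplevel_zero emeasure_half_line)

lemma rearr_set_bdd: "bdd_above {c. 0 \<le> c \<and> c \<le> K \<and> ennreal s \<le> emeasure lborel (suplevel H c)}"
  by (rule bdd_aboveI[of _ K]) auto

lemma rearr_nonneg: "0 \<le> rearr K H s"
  unfolding rearr_def using rearr_set_nonempty rearr_set_bdd by (rule cSup_upper)

lemma rearr_le: "rearr K H s \<le> K"
  unfolding rearr_def using rearr_set_nonempty by (intro cSup_least) auto

lemma rearr_ge:
  "0 \<le> c \<Longrightarrow> c \<le> K \<Longrightarrow> ennreal s \<le> emeasure lborel (suplevel H c) \<Longrightarrow> c \<le> rearr K H s"
  unfolding rearr_def using rearr_set_bdd by (intro cSup_upper) auto

text \<open>Restricting to levels strictly below the supremum avoids the question of attainment and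
  loses only a null set when integrating over levels.\<close>

lemma less_rearrD:
  assumes "c < rearr K H s"
  shows "ennreal s \<le> emeasure lborel (suplevel H c)"
proof -
  obtain d where "c < d" "ennreal s \<le> emeasure lborel (suplevel H d)"
    using assms less_cSup_iff[OF _ rearr_set_bdd] rearr_set_nonempty unfolding rearr_def
    by (metis (mono_tags, lifting) empty_iff mem_Collect_eq)
  then show ?thesis using emeasure_suplevel_antimono[OF bump_meas, of c d] by (meson order.trans less_imp_le)
qed

lemma rearr_antimono: "s \<le> s' \<Longrightarrow> rearr K H s' \<le> rearr K H s"
  unfolding rearr_def
  using rearr_set_nonempty[of s'] by (intro cSup_subset_mono rearr_set_bdd) (auto dest: ennreal_leI order.trans)

lemma rearr_eq_0:
  assumes "R < s"
  shows "rearr K H s = 0"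
proof (rule ccontr)
  assume "rearr K H s \<noteq> 0"
  then have "0 < rearr K H s" using rearr_nonneg[of s] by simp
  then obtain c where c: "0 < c" "c < rearr K H s" using dense by blast
  have "suplevel H c \<subseteq> {0..R}"
    using c(1) bump unfolding suplevel_def bump_def by (smt (verit) atLeastAtMost_iff mem_Collect_eq subsetI)
  then have "emeasure lborel (suplevel H c) \<le> emeasure lborel {0..R}"
    by (intro emeasure_mono) auto
  also have "\<dots> = ennreal R" using bump_bounds by simp
  finally have "ennreal s \<le> ennreal R" by (rule order.trans[OF less_rearrD[OF c(2)]])
  then show False using assms bump_bounds by (simp add: ennreal_le_iff)
qed

lemma adm_fun_rearr: "adm_fun (rearr K H)"
  unfolding adm_fun_def
proof (intro conjI allI impI)
  fix x :: real assume x: "0 < x"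
  show "(rearr K H \<longlongrightarrow> rearr K H x) (at_left x)"
  proof (rule order_tendstoI)
    fix a assume "a < rearr K H x"
    then show "eventually (\<lambda>y. a < rearr K H y) (at_left x)"
      unfolding eventually_at_left_field
      by (intro exI[of _ "x - 1"]) (auto intro: order.strict_trans2[OF _ rearr_antimono])
  next
    fix a assume a: "rearr K H x < a"
    have "\<exists>s<x. rearr K H s < a"
    proof (rule ccontr)
      assume "\<not> ?thesis"
      then have *: "a \<le> rearr K H s" if "s < x" for s using that by (meson not_le)
      \<comment> \<open>The superlevel set of this intermediate level has measure at least every
        \<open>s < x\<close>, hence at least \<open>x\<close>, so \<open>c\<close> competes in the
        supremum at \<open>x\<close> itself.\<close>
      obtain c where c: "rearr K H x < c" "c < a" using a dense by blast
      have "ennreal s \<le> emeasure lborel (suplevel H c)" if "s < x" for s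
        using less_rearrD *[OF that] c by force
      then have below: "ennreal s \<le> emeasure lborel (suplevel H c)" if "s < x" for s using that by blast
      have "ennreal x \<le> emeasure lborel (suplevel H c)"
      proof (rule dense_le)
        fix y assume y: "y < ennreal x"
        then obtain s where "y = ennreal s" "0 \<le> s" by (cases y) auto
        then show "y \<le> emeasure lborel (suplevel H c)" using below y by (simp add: ennreal_less_iff)
      qed
      moreover have "c \<le> K" using * [of "x - 1"] rearr_le[of "x - 1"] c by simp
      moreover have "0 \<le> c" using c rearr_nonneg[of x] by simp
      ultimately show False using rearr_ge[of c x] c by simp
    qed
    then obtain s where "s < x" "rearr K H s < a" by blast
    then show "eventually (\<lambda>y. rearr K H y < a) (at_left x)"
      unfolding eventually_at_left_field using rearr_antimono by (meson less_imp_le order_le_less_trans)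
  qed
next
  show "\<exists>R. \<forall>x\<ge>R. rearr K H x = 0" using rearr_eq_0 by (intro exI[of _ "R + 1"]) auto
qed (use rearr_nonneg rearr_antimono in auto)

lemma half_line_integral_rearr_le: "half_line_integral (rearr K H) \<le> half_line_integral H"
proof -
  note bump_meas [measurable]
  define m where "m c = emeasure lborel (suplevel H c)" for c
  have "{p \<in> space (borel \<Otimes>\<^sub>M borel). 0 \<le> snd p \<and> fst p \<le> H (snd p)} \<in> sets (borel \<Otimes>\<^sub>M borel)"
    by measurable
  then have [measurable]: "{(c, x). 0 \<le> x \<and> c \<le> H x} \<in> sets (borel \<Otimes>\<^sub>M borel)"
    by (simp add: space_pair_measure case_prod_beta')
  have "{p \<in> space (borel \<Otimes>\<^sub>M borel). 0 \<le> fst p \<and> snd p \<le> H (fst p)} \<in> sets (borel \<Otimes>\<^sub>M borel)"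
    by measurable
  then have [measurable]: "{(t, c). 0 \<le> t \<and> c \<le> H t} \<in> sets (borel \<Otimes>\<^sub>M borel)"
    by (simp add: space_pair_measure case_prod_beta')
  have "(\<lambda>c. emeasure lborel (Pair c -` {(c, x). 0 \<le> x \<and> c \<le> H x})) \<in> borel_measurable borel"
    by (rule lborel.measurable_emeasure_Pair) measurable
  then have m [measurable]: "m \<in> borel_measurable borel"
    by (simp add: m_def[abs_def] suplevel_def vimage_def)
  have "half_line_integral (rearr K H)
      = (\<integral>\<^sup>+s. (\<integral>\<^sup>+c. indicator {0..} s * indicator {0<..<rearr K H s} c \<partial>lborel) \<partial>lborel)"
    unfolding half_line_integral_def
    using rearr_nonneg by (intro nn_integral_cong) (simp add: nn_integral_cmult mult.commute)
  also have "\<dots> \<le> (\<integral>\<^sup>+s. (\<integral>\<^sup>+c. indicator {0..} s * indicator {0<..} c *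
      indicator {(s, c). ennreal s \<le> m c} (s, c) \<partial>lborel) \<partial>lborel)"
    by (intro nn_integral_mono) (auto split: split_indicator simp: m_def less_rearrD)
  also have "\<dots> = (\<integral>\<^sup>+c. (\<integral>\<^sup>+s. indicator {0..} s * indicator {0<..} c *
      indicator {(s, c). ennreal s \<le> m c} (s, c) \<partial>lborel) \<partial>lborel)"
    by (subst lborel_pair.Fubini'[symmetric]) auto
  also have "\<dots> \<le> (\<integral>\<^sup>+c. indicator {0<..} c * m c \<partial>lborel)"
  proof (rule nn_integral_mono)
    fix c
    have "(\<integral>\<^sup>+s. indicator {0..} s * indicator {0<..} c *
      indicator {(s, c). ennreal s \<le> m c} (s, c) \<partial>lborel)
      = (\<integral>\<^sup>+s. indicator {0<..} c * indicator {s. 0 \<le> s \<and> ennreal s \<le> m c} s \<partial>lborel)"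
      by (intro nn_integral_cong) (auto split: split_indicator)
    also have "\<dots> = indicator {0<..} c * emeasure lborel {s. 0 \<le> s \<and> ennreal s \<le> m c}"
      by (subst nn_integral_cmult) auto
    also have "emeasure lborel {s. 0 \<le> s \<and> ennreal s \<le> m c} \<le> m c"
    proof (cases "m c")
      case (real r)
      then have "{s. 0 \<le> s \<and> ennreal s \<le> m c} = {0..r}" by (auto simp: ennreal_le_iff)
      then show ?thesis using real by simp
    qed simp
    finally show "(\<integral>\<^sup>+s. indicator {0..} s * indicator {0<..} c *
      indicator {(s, c). ennreal s \<le> m c} (s, c) \<partial>lborel) \<le> indicator {0<..} c * m c"
      by (simp add: mult_left_mono)
  qed
  also have "\<dots> = (\<integral>\<^sup>+c. (\<integral>\<^sup>+t. indicator {0<..} c * indicator {(t, c). 0 \<le> t \<and> c \<le> H t} (t, c) \<partial>lborel) \<partial>lborel)"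
  proof (rule nn_integral_cong)
    fix c
    have "m c = (\<integral>\<^sup>+t. indicator (suplevel H c) t \<partial>lborel)" by (simp add: m_def)
    also have "\<dots> = (\<integral>\<^sup>+t. indicator {(t, c). 0 \<le> t \<and> c \<le> H t} (t, c) \<partial>lborel)"
      by (intro nn_integral_cong) (auto split: split_indicator simp: suplevel_def)
    finally show "indicator {0<..} c * m c =
        (\<integral>\<^sup>+t. indicator {0<..} c * indicator {(t, c). 0 \<le> t \<and> c \<le> H t} (t, c) \<partial>lborel)"
      by (subst nn_integral_cmult) auto
  qed
  also have "\<dots> = (\<integral>\<^sup>+t. (\<integral>\<^sup>+c. indicator {0<..} c * indicator {(t, c). 0 \<le> t \<and> c \<le> H t} (t, c) \<partial>lborel) \<partial>lborel)"
    by (subst lborel_pair.Fubini') auto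
  also have "\<dots> = half_line_integral H"
    unfolding half_line_integral_def
  proof (rule nn_integral_cong)
    fix t
    have "(\<integral>\<^sup>+c. indicator {0<..} c * indicator {(t, c). 0 \<le> t \<and> c \<le> H t} (t, c) \<partial>lborel)
      = (\<integral>\<^sup>+c. indicator {0..} t * indicator {0<..H t} c \<partial>lborel)"
      by (intro nn_integral_cong) (auto split: split_indicator)
    also have "\<dots> = ennreal (H t) * indicator {0..} t"
      using bump_bounds by (subst nn_integral_cmult) (auto split: split_indicator)
    finally show "(\<integral>\<^sup>+c. indicator {0<..} c * indicator {(t, c). 0 \<le> t \<and> c \<le> H t} (t, c) \<partial>lborel)
      = ennreal (H t) * indicator {0..} t" .
  qed
  finally show ?thesis .
qed

section \<open>Ranks and the comparison of sections\<close>

text \<open>The rank of \<open>t\<close> is the measure of the superlevel set at its own height. The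
  heights of rank at most \<open>L\<close> form an up-set \<open>U\<close>, so the points in
  question form a superlevel set at \<open>Inf U\<close>, and its measure is controlled by
  \<open>L\<close>.\<close>

lemma emeasure_rank_le:
  "emeasure lborel {t. 0 \<le> t \<and> emeasure lborel (suplevel H (H t)) \<le> L} \<le> L"
    and rank_set_borel: "{t. 0 \<le> t \<and> emeasure lborel (suplevel H (H t)) \<le> L} \<in> sets borel"
proof -
  note bump_meas [measurable]
  define U where "U = {c. 0 \<le> c \<and> emeasure lborel (suplevel H c) \<le> L}"
  define T where "T = {t. 0 \<le> t \<and> emeasure lborel (suplevel H (H t)) \<le> L}"
  have T: "T = {t. 0 \<le> t \<and> H t \<in> U}" using bump_bounds by (auto simp: T_def U_def)
  have up: "d \<in> U" if "c \<in> U" "c \<le> d" for c d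
    using that emeasure_suplevel_antimono[OF bump_meas that(2)] by (auto simp: U_def)
  have "T \<in> sets borel \<and> emeasure lborel T \<le> L"
  proof (cases "U = {}")
    case True
    then show ?thesis by (simp add: T)
  next
    case ne: False
    have bdd: "bdd_below U" by (rule bdd_belowI[of _ 0]) (auto simp: U_def)
    show ?thesis
    \<comment> \<open>If the infimum is attained, \<open>T\<close> is the weak superlevel set at
      that height; otherwise it is the strict one, an increasing union of weak ones of measure at
      most \<open>L\<close>.\<close>
    proof (cases "Inf U \<in> U")
      case True
      then have "T = suplevel H (Inf U)"
        using up[OF True] cInf_lower[OF _ bdd] unfolding T suplevel_def by blast
      then show ?thesis using True by (auto simp: U_def)
    next
      case False
      let ?S = "\<lambda>n. suplevel H (Inf U + 1 / real (Suc n))"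
      have inU: "c \<in> U" if "Inf U < c" for c
        using that up cInf_less_iff[OF ne bdd] by (meson less_imp_le)
      have TS: "T = (\<Union>n. ?S n)"
      proof (intro set_eqI iffI)
        fix t assume "t \<in> T"
        then have t: "0 \<le> t" "Inf U < H t"
          using False cInf_lower[OF _ bdd, of "H t"] by (auto simp: T order.strict_iff_order)
        then obtain n where "1 / real (Suc n) < H t - Inf U"
          using nat_approx_posE[of "H t - Inf U"] by auto
        then show "t \<in> (\<Union>n. ?S n)" using t by (auto simp: suplevel_def intro!: exI[of _ n])
      next
        fix t assume "t \<in> (\<Union>n. ?S n)"
        then obtain n where "0 \<le> t" "Inf U + 1 / real (Suc n) \<le> H t" by (auto simp: suplevel_def)
        moreover have "0 < 1 / real (Suc n)" by simp
        ultimately have "0 \<le> t" "Inf U < H t" by linarith+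
        then show "t \<in> T" using inU by (auto simp: T)
      qed
      have sup: "(SUP n. emeasure lborel (?S n)) = emeasure lborel (\<Union>n. ?S n)"
      proof (rule SUP_emeasure_incseq)
        show "incseq ?S"
          by (intro incseq_SucI suplevel_antimono) (auto simp: field_simps)
      qed auto
      have "emeasure lborel (?S n) \<le> L" for n
        using inU[of "Inf U + 1 / real (Suc n)"] by (simp add: U_def)
      then have "emeasure lborel T \<le> L" unfolding TS sup[symmetric] by (rule SUP_least)
      then show ?thesis unfolding TS by auto
    qed
  qed
  then show "emeasure lborel {t. 0 \<le> t \<and> emeasure lborel (suplevel H (H t)) \<le> L} \<le> L"
    "{t. 0 \<le> t \<and> emeasure lborel (suplevel H (H t)) \<le> L} \<in> sets borel"
    by (simp_all add: T_def)
qed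

end

text \<open>If \<open>S\<close> contains all \<open>s\<close> up to the rank of \<open>t\<close>,
  that rank is at most the measure of \<open>S\<close>; the rank bound then limits how many such
  \<open>t\<close> there are. Here \<open>X\<close> is a section of the grown set, \<open>X'\<close>
  that of \<open>A\<close>, and \<open>S\<close> the matched section of the rearranged
  growth.\<close>

lemma emeasure_section_le:
  assumes bump: "bump R K H" and X': "X' \<in> sets borel" and S: "S \<in> sets borel"
    and X: "\<And>t. t \<in> X \<Longrightarrow> 0 \<le> t \<and> (t \<in> X' \<or>
      (\<forall>s\<ge>0. ennreal s \<le> emeasure lborel (suplevel H (H t)) \<longrightarrow> s \<in> S))"
  shows "emeasure lebesgue X \<le> emeasure lebesgue X' + emeasure lebesgue S"
proof -
  define L where "L = emeasure lborel S"
  define T where "T = {t. 0 \<le> t \<and> emeasure lborel (suplevel H (H t)) \<le> L}"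
  have T: "T \<in> sets borel" "emeasure lborel T \<le> L"
    unfolding T_def using emeasure_rank_le[OF bump] rank_set_borel[OF bump] by auto
  have "emeasure lborel (suplevel H (H t)) \<le> L"
    if "\<forall>s\<ge>0. ennreal s \<le> emeasure lborel (suplevel H (H t)) \<longrightarrow> s \<in> S" for t
  proof (cases "emeasure lborel (suplevel H (H t))")
    case (real r)
    then have "{0..r} \<subseteq> S" using that by auto
    then have "emeasure lborel {0..r} \<le> L" unfolding L_def using S by (intro emeasure_mono) auto
    then show ?thesis using real by simp
  next
    case top
    then have "{0..} \<subseteq> S" using that by auto
    then have "emeasure lborel {0::real..} \<le> L" unfolding L_def using S by (intro emeasure_mono) auto
    then show ?thesis using emeasure_half_line by (simp add: top_unique)
  qed
  then have "X \<subseteq> X' \<union> T" using X by (auto simp: T_def)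
  then have "emeasure lebesgue X \<le> emeasure lebesgue (X' \<union> T)"
    using X' T by (intro emeasure_mono) auto
  also have "\<dots> \<le> emeasure lebesgue X' + emeasure lebesgue T"
    using X' T by (intro emeasure_subadditive) auto
  also have "\<dots> \<le> emeasure lebesgue X' + emeasure lebesgue S"
    using T S by (intro add_left_mono) (simp add: emeasure_lebesgue_borel L_def)
  finally show ?thesis .
qed

lemma sections_borel:
  fixes A :: "(real \<times> real) set"
  assumes A: "A \<in> sets borel"
  shows "{t. (t, v) \<in> A} \<in> sets borel" "{s. (u, s) \<in> A} \<in> sets borel"
proof -
  have "(\<lambda>t. (t, v)) -` A \<inter> space borel \<in> sets borel"
    using A by (intro measurable_sets borel_measurable_continuous_onI) (auto intro: continuous_intros)
  then show "{t. (t, v) \<in> A} \<in> sets borel" by (simp add: vimage_def)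
  have "(\<lambda>s. (u, s)) -` A \<inter> space borel \<in> sets borel"
    using A by (intro measurable_sets borel_measurable_continuous_onI) (auto intro: continuous_intros)
  then show "{s. (u, s) \<in> A} \<in> sets borel" by (simp add: vimage_def)
qed

text \<open>Points grown from \<open>A\<close> are matched with points of the rearranged dynamics through the
  ranks of their row and column; a row of the grown set then exceeds the matched row only by
  the part inside \<open>A\<close>, which has been put into \<open>F\<close>.\<close>

lemma Espans_rearr:
  assumes Z: "lower_set Z" and sp: "Espans Z f g A"
    and A: "A \<in> sets borel" "A \<subseteq> {0..R} \<times> {0..R}"
    and F: "bump R K F" and G: "bump R K G"
    and f: "\<And>v. 0 \<le> v \<Longrightarrow> erow (0, v) A + ennreal (f v) \<le> ennreal (F v)"
    and g: "\<And>u. 0 \<le> u \<Longrightarrow> ecol (u, 0) A + ennreal (g u) \<le> ennreal (G u)"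
  shows "Espans Z (rearr K F) (rearr K G) {}"
proof -
  define B where "B n = (ET Z (rearr K F) (rearr K G) ^^ n) {}" for n
  let ?A = "\<lambda>n. (ET Z f g ^^ n) A"
  have low: "lower_set (B n)" for n
    unfolding B_def using lower_set_ET_iter[OF Z] rearr_antimono[OF F] rearr_antimono[OF G] by blast
  have Aq: "A \<subseteq> quadrant" using A by (auto simp: quadrant_def)
  have dom: "(s, r) \<in> B n"
    if "(u, v) \<in> ?A n" "(u, v) \<notin> A" "0 \<le> s" "ennreal s \<le> emeasure lborel (suplevel G (G u))"
      "0 \<le> r" "ennreal r \<le> emeasure lborel (suplevel F (F v))" for n u v s r
    using that
  proof (induction n arbitrary: u v s r)
    case (Suc n)
    show ?case
    proof (cases "(u, v) \<in> ?A n")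
      case True
      then have "(s, r) \<in> B n" using Suc by blast
      then show ?thesis by (simp add: B_def ET_iff)
    next
      case False
      then have uv: "0 \<le> u" "0 \<le> v"
        and out: "\<not> in_zs (erow (u, v) (?A n) + ennreal (f v), ecol (u, v) (?A n) + ennreal (g u)) Z"
        using Suc.prems(1) by (simp_all add: ET_iff)
      \<comment> \<open>Along a row the first coordinate varies, so its ranks are taken with respect
        to \<open>G\<close>; by the induction hypothesis a point of the row outside \<open>A\<close>
        contributes all its ranks to the matched row.\<close>
      have "erow (u, v) (?A n) \<le> erow (0, v) A + erow (s, r) (B n)"
        unfolding erow_def
        by (rule emeasure_section_le[OF G])
          (use Suc.IH Suc.prems sections_borel[OF A(1)] lower_set_sections_borel[OF low]
            ET_iter_nonneg[OF _ Aq] in auto)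
      then have "erow (u, v) (?A n) + ennreal (f v) \<le> erow (0, v) A + erow (s, r) (B n) + ennreal (f v)"
        by (rule add_right_mono)
      also have "\<dots> = erow (s, r) (B n) + (erow (0, v) A + ennreal (f v))" by (simp add: ac_simps)
      also have "\<dots> \<le> erow (s, r) (B n) + ennreal (F v)" by (rule add_left_mono[OF f[OF uv(2)]])
      \<comment> \<open>The level \<open>F v\<close> has a superlevel set of measure at least
        \<open>r\<close>, so it competes in the supremum defining
        \<open>rearr K F r\<close>.\<close>
      also have "\<dots> \<le> erow (s, r) (B n) + ennreal (rearr K F r)"
        using rearr_ge[OF F] bump_bounds[OF F] uv Suc.prems by (intro add_left_mono ennreal_leI) auto
      finally have row: "erow (u, v) (?A n) + ennreal (f v) \<le> erow (s, r) (B n) + ennreal (rearr K F r)" .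
      have "ecol (u, v) (?A n) \<le> ecol (u, 0) A + ecol (s, r) (B n)"
        unfolding ecol_def
        by (rule emeasure_section_le[OF F])
          (use Suc.IH Suc.prems sections_borel[OF A(1)] lower_set_sections_borel[OF low]
            ET_iter_nonneg[OF _ Aq] in auto)
      then have "ecol (u, v) (?A n) + ennreal (g u) \<le> ecol (u, 0) A + ecol (s, r) (B n) + ennreal (g u)"
        by (rule add_right_mono)
      also have "\<dots> = ecol (s, r) (B n) + (ecol (u, 0) A + ennreal (g u))" by (simp add: ac_simps)
      also have "\<dots> \<le> ecol (s, r) (B n) + ennreal (G u)" by (rule add_left_mono[OF g[OF uv(1)]])
      also have "\<dots> \<le> ecol (s, r) (B n) + ennreal (rearr K G s)"
        using rearr_ge[OF G] bump_bounds[OF G] uv Suc.prems by (intro add_left_mono ennreal_leI) auto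
      finally have col: "ecol (u, v) (?A n) + ennreal (g u) \<le> ecol (s, r) (B n) + ennreal (rearr K G s)" .
      have "\<not> in_zs (erow (s, r) (B n) + ennreal (rearr K F r), ecol (s, r) (B n) + ennreal (rearr K G s)) Z"
        using in_zs_mono[OF Z _ row col] out by blast
      then show ?thesis using Suc.prems by (simp add: B_def ET_iff)
    qed
  qed simp
  \<comment> \<open>This point lies outside \<open>A\<close> and both \<open>F\<close> and
    \<open>G\<close> vanish at its coordinates. Its ranks are infinite, so the step at which it is
    reached matches the whole quadrant.\<close>
  have "(R + 1, R + 1) \<in> (\<Union>n. ?A n)"
    using sp bump_bounds(4)[OF F] by (auto simp: Espans_def quadrant_def)
  then obtain n where n: "(R + 1, R + 1) \<in> ?A n" by blast
  have notA: "(R + 1, R + 1) \<notin> A" using A(2) by auto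
  have "F (R + 1) = 0" "G (R + 1) = 0" using bump_eq_0[OF F] bump_eq_0[OF G] by simp_all
  then have "(s, r) \<in> B n" if "0 \<le> s" "0 \<le> r" for s r
    using dom[OF n notA that(1) _ that(2)]
    by (simp add: emeasure_half_line suplevel_zero[OF F] suplevel_zero[OF G])
  then have "quadrant \<subseteq> (\<Union>n. B n)" by (auto simp: quadrant_def)
  moreover have "(\<Union>n. B n) \<subseteq> quadrant" using low by (auto simp: lower_set_def)
  ultimately show ?thesis unfolding Espans_def B_def by blast
qed

section \<open>Integrals of enhancements and absorption of a compact set\<close>

text \<open>\<open>adm_fun\<close> says nothing about negative arguments, so monotonicity is
  exploited after freezing the argument at 0.\<close>

lemma adm_fun_borel:
  assumes "adm_fun f"
  shows "(\<lambda>x. f x * indicator {0..} x) \<in> borel_measurable borel"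
proof -
  have "mono (\<lambda>x. - f (max 0 x))"
    using assms by (intro monoI) (auto simp: adm_fun_def max_def)
  then have "(\<lambda>x. - (- f (max 0 x))) \<in> borel_measurable borel"
    by (intro borel_measurable_uminus borel_measurable_mono)
  then have [measurable]: "(\<lambda>x. f (max 0 x)) \<in> borel_measurable borel" by simp
  have "(\<lambda>x. f (max 0 x) * indicator {0..} x) \<in> borel_measurable borel" by measurable
  moreover have "(\<lambda>x. f (max 0 x) * indicator {0..} x) = (\<lambda>x. f x * indicator {0..} x)"
    by (auto split: split_indicator)
  ultimately show ?thesis by simp
qed

lemma half_line_integral_indicator:
  "half_line_integral f = (\<integral>\<^sup>+x. ennreal (f x * indicator {0..} x) \<partial>lborel)"
  unfolding half_line_integral_def by (intro nn_integral_cong) (auto split: split_indicator)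

text \<open>The bridge between the gauge integral in the costs and the nonnegative Lebesgue
  integral, where Tonelli applies. Finiteness comes from the bound \<open>f 0\<close> and the
  bounded support.\<close>

lemma adm_fun_integral:
  assumes f: "adm_fun f"
  shows "half_line_integral f = ennreal (integral {0..} f)" "f integrable_on {0..}"
    "0 \<le> integral {0..} f"
proof -
  let ?h = "\<lambda>x. f x * indicator {0..} x"
  have nn: "0 \<le> ?h x" for x using f by (auto simp: adm_fun_def split: split_indicator)
  obtain R where R: "\<forall>x\<ge>R. f x = 0" using f by (auto simp: adm_fun_def)
  have "half_line_integral f \<le> (\<integral>\<^sup>+x. ennreal (f 0) * indicator {0..max 0 R} x \<partial>lborel)"
    unfolding half_line_integral_def
    using f R by (intro nn_integral_mono) (auto simp: adm_fun_def max_def intro!: ennreal_leI split: split_indicator)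
  also have "\<dots> < \<infinity>" by (simp add: nn_integral_cmult ennreal_mult_less_top)
  finally obtain r where r: "half_line_integral f = ennreal r" "0 \<le> r"
    by (metis ennreal_cases infinity_ennreal_def order_less_irrefl)
  have "(?h has_integral r) UNIV"
    by (rule nn_integral_has_integral[OF adm_fun_borel[OF f]])
      (use nn r in \<open>auto simp: half_line_integral_indicator\<close>)
  then have "((\<lambda>x. if x \<in> {0..} then f x else 0) has_integral r) UNIV"
    by (rule has_integral_eq[rotated]) auto
  then have "(f has_integral r) {0..}" by (simp only: has_integral_restrict_UNIV)
  then show "half_line_integral f = ennreal (integral {0..} f)" "f integrable_on {0..}"
    "0 \<le> integral {0..} f"
    using r by (auto simp: integral_unique)
qed

lemma section_measures:
  fixes A :: "(real \<times> real) set"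
  assumes A: "A \<in> sets borel"
  shows "(\<lambda>v. emeasure lborel {t. (t, v) \<in> A}) \<in> borel_measurable borel"
    "(\<lambda>u. emeasure lborel {s. (u, s) \<in> A}) \<in> borel_measurable borel"
    "(\<integral>\<^sup>+v. emeasure lborel {t. (t, v) \<in> A} \<partial>lborel) = emeasure lborel A"
    "(\<integral>\<^sup>+u. emeasure lborel {s. (u, s) \<in> A} \<partial>lborel) = emeasure lborel A"
proof -
  have A': "A \<in> sets (lborel \<Otimes>\<^sub>M lborel)" unfolding lborel_prod using A by simp
  show "(\<lambda>v. emeasure lborel {t. (t, v) \<in> A}) \<in> borel_measurable borel"
    using lborel_pair.measurable_emeasure_Pair2[OF A'] by (simp add: vimage_def)
  show "(\<lambda>u. emeasure lborel {s. (u, s) \<in> A}) \<in> borel_measurable borel"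
    using lborel.measurable_emeasure_Pair[OF A'] by (simp add: vimage_def)
  show "(\<integral>\<^sup>+v. emeasure lborel {t. (t, v) \<in> A} \<partial>lborel) = emeasure lborel A"
    using lborel_pair.emeasure_pair_measure_alt2[OF A'] by (simp add: vimage_def lborel_prod)
  show "(\<integral>\<^sup>+u. emeasure lborel {s. (u, s) \<in> A} \<partial>lborel) = emeasure lborel A"
    using lborel.emeasure_pair_measure_alt[OF A'] by (simp add: vimage_def lborel_prod)
qed

text \<open>An abstract family \<open>S\<close> serves the rows and the columns of a compact set,
  and later also the rows of a translated zero-set.\<close>

lemma bump_add_sections:
  assumes f: "adm_fun f" and fR: "\<And>x. R < x \<Longrightarrow> f x = 0" and K: "f 0 + R \<le> K" and R: "0 \<le> R"
    and S: "\<And>x. S x \<subseteq> {0..R}" "\<And>x. S x \<in> sets borel" "\<And>x. R < x \<Longrightarrow> S x = {}"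
    and m: "(\<lambda>x. emeasure lborel (S x)) \<in> borel_measurable borel"
  defines "F \<equiv> \<lambda>x. f x * indicator {0..} x + measure lborel (S x)"
  shows "bump R K F"
    "half_line_integral F \<le> half_line_integral f + (\<integral>\<^sup>+x. emeasure lborel (S x) \<partial>lborel)"
    "\<And>x. 0 \<le> x \<Longrightarrow> emeasure lebesgue (S x) + ennreal (f x) \<le> ennreal (F x)"
proof -
  have e: "emeasure lborel (S x) \<le> ennreal R" for x
  proof -
    have "emeasure lborel (S x) \<le> emeasure lborel {0..R}" using S by (intro emeasure_mono) auto
    then show ?thesis using R by simp
  qed
  then have em: "emeasure lborel (S x) = ennreal (measure lborel (S x))" for x
    by (intro emeasure_eq_ennreal_measure) (metis ennreal_less_top order_le_less_trans order_less_irrefl)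
  have mR: "measure lborel (S x) \<le> R" for x using e[of x] R by (simp add: em)
  have nn: "0 \<le> f x" if "0 \<le> x" for x using f that by (auto simp: adm_fun_def)
  have [measurable]: "(\<lambda>x. f x * indicator {0..} x) \<in> borel_measurable borel"
    by (rule adm_fun_borel[OF f])
  have [measurable]: "(\<lambda>x. measure lborel (S x)) \<in> borel_measurable borel"
    using m unfolding measure_def by measurable
  have "F x \<le> K" if "0 \<le> x" for x
  proof -
    have "f x \<le> f 0" using f that by (auto simp: adm_fun_def)
    then show ?thesis using mR[of x] K that by (simp add: F_def)
  qed
  then show "bump R K F"
    unfolding bump_def using R fR nn S(3) by (auto simp: F_def)
  have "half_line_integral F \<le> (\<integral>\<^sup>+x. ennreal (f x * indicator {0..} x) + emeasure lborel (S x) \<partial>lborel)"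
    unfolding half_line_integral_def
    using nn by (intro nn_integral_mono) (auto simp: F_def em split: split_indicator)
  also have "\<dots> = half_line_integral f + (\<integral>\<^sup>+x. emeasure lborel (S x) \<partial>lborel)"
    unfolding half_line_integral_indicator using m by (intro nn_integral_add) auto
  finally show "half_line_integral F \<le> half_line_integral f + (\<integral>\<^sup>+x. emeasure lborel (S x) \<partial>lborel)" .
  show "emeasure lebesgue (S x) + ennreal (f x) \<le> ennreal (F x)" if "0 \<le> x" for x
    using that nn S(2) by (simp add: F_def em emeasure_lebesgue_borel add.commute)
qed

lemma integral_rearr_le:
  assumes "bump R K F" "half_line_integral F \<le> ennreal a" "0 \<le> a"
  shows "integral {0..} (rearr K F) \<le> a"
proof -
  have "half_line_integral (rearr K F) \<le> ennreal a"
    using half_line_integral_rearr_le[OF assms(1)] assms(2) by (rule order.trans)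
  then show ?thesis
    using adm_fun_integral[OF adm_fun_rearr[OF assms(1)]] assms(3) by simp
qed

lemma Espans_subset_quadrant:
  assumes "Espans Z f g A"
  shows "A \<subseteq> quadrant"
proof -
  have "A \<subseteq> (\<Union>n. (ET Z f g ^^ n) A)" by (auto intro!: exI[of _ "0::nat"])
  then show ?thesis using assms by (simp add: Espans_def)
qed

text \<open>By Tonelli the row lengths and the column lengths of \<open>A\<close> both integrate to
  its area, which is why each enhancement pays for it once.\<close>

lemma thin_spanning:
  assumes Z: "lower_set Z" and sp: "Espans Z f g A" and A: "compact A"
    and f: "adm_fun f" and g: "adm_fun g"
  obtains F G where "adm_fun F" "adm_fun G" "Espans Z F G {}"
    "integral {0..} F \<le> integral {0..} f + measure lebesgue A"
    "integral {0..} G \<le> integral {0..} g + measure lebesgue A"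
proof -
  have Aq: "A \<subseteq> quadrant" by (rule Espans_subset_quadrant[OF sp])
  obtain B where B: "\<forall>p\<in>A. norm p \<le> B" using compact_imp_bounded[OF A] by (auto simp: bounded_iff)
  obtain Rf where Rf: "\<forall>x\<ge>Rf. f x = 0" using f by (auto simp: adm_fun_def)
  obtain Rg where Rg: "\<forall>x\<ge>Rg. g x = 0" using g by (auto simp: adm_fun_def)
  define R where "R = \<bar>B\<bar> + \<bar>Rf\<bar> + \<bar>Rg\<bar>"
  define K where "K = f 0 + g 0 + R"
  have AR: "A \<subseteq> {0..R} \<times> {0..R}"
  proof
    fix p assume "p \<in> A"
    then have "norm p \<le> B" "p \<in> quadrant" using B Aq by auto
    moreover have "\<bar>fst p\<bar> \<le> norm p" "\<bar>snd p\<bar> \<le> norm p"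
      by (metis norm_fst_le norm_snd_le prod.collapse real_norm_def)+
    ultimately show "p \<in> {0..R} \<times> {0..R}" by (auto simp: R_def quadrant_def)
  qed
  have Ab: "A \<in> sets borel" using A by (simp add: borel_compact)
  have R: "0 \<le> R" "\<And>x. R < x \<Longrightarrow> f x = 0" "\<And>x. R < x \<Longrightarrow> g x = 0"
    using Rf Rg by (auto simp: R_def)
  have K: "f 0 + R \<le> K" "g 0 + R \<le> K" using f g by (auto simp: K_def adm_fun_def)
  define F where "F = (\<lambda>v. f v * indicator {0..} v + measure lborel {t. (t, v) \<in> A})"
  define G where "G = (\<lambda>u. g u * indicator {0..} u + measure lborel {s. (u, s) \<in> A})"
  have "{t. (t, v) \<in> A} \<subseteq> {0..R}" "R < v \<Longrightarrow> {t. (t, v) \<in> A} = {}" for v using AR by auto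
  note Fb = bump_add_sections[OF f R(2) K(1) R(1) this(1) sections_borel(1)[OF Ab] this(2)
      section_measures(1)[OF Ab], folded F_def]
  have "{s. (u, s) \<in> A} \<subseteq> {0..R}" "R < u \<Longrightarrow> {s. (u, s) \<in> A} = {}" for u using AR by auto
  note Gb = bump_add_sections[OF g R(3) K(2) R(1) this(1) sections_borel(2)[OF Ab] this(2)
      section_measures(2)[OF Ab], folded G_def]
  have sp': "Espans Z (rearr K F) (rearr K G) {}"
    by (rule Espans_rearr[OF Z sp Ab AR Fb(1) Gb(1)]) (use Fb(3) Gb(3) in \<open>auto simp: erow_def ecol_def F_def G_def\<close>)
  have area: "emeasure lborel A = ennreal (measure lebesgue A)"
    using Ab emeasure_compact_finite[OF A] by (simp add: measure_def less_top)
  have "half_line_integral F \<le> ennreal (integral {0..} f + measure lebesgue A)"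
    using Fb(2) by (simp add: section_measures[OF Ab] area adm_fun_integral[OF f])
  then have "integral {0..} (rearr K F) \<le> integral {0..} f + measure lebesgue A"
    using adm_fun_integral[OF f] by (intro integral_rearr_le[OF Fb(1)]) auto
  moreover have "half_line_integral G \<le> ennreal (integral {0..} g + measure lebesgue A)"
    using Gb(2) by (simp add: section_measures[OF Ab] area adm_fun_integral[OF g])
  then have "integral {0..} (rearr K G) \<le> integral {0..} g + measure lebesgue A"
    using adm_fun_integral[OF g] by (intro integral_rearr_le[OF Gb(1)]) auto
  ultimately show thesis
    using that adm_fun_rearr[OF Fb(1)] adm_fun_rearr[OF Gb(1)] sp' by blast
qed

section \<open>Bounded zero-sets\<close>

text \<open>Collects what truncation to a box preserves for every \<open>R \<ge> 0\<close>. The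
  closure condition on zero-sets fails at \<open>R = 0\<close> when \<open>Z\<close> is nonempty,
  since only the origin is left.\<close>

definition zero_region :: "real \<Rightarrow> (real \<times> real) set \<Rightarrow> bool" where
  "zero_region R Z \<longleftrightarrow> 0 \<le> R \<and> closed Z \<and> lower_set Z \<and> Z \<subseteq> {0..R} \<times> {0..R}"

lemma zero_regionD:
  assumes "zero_region R Z"
  shows "0 \<le> R" "closed Z" "lower_set Z" "Z \<subseteq> {0..R} \<times> {0..R}" "compact Z"
proof -
  show *: "0 \<le> R" "closed Z" "lower_set Z" "Z \<subseteq> {0..R} \<times> {0..R}"
    using assms by (auto simp: zero_region_def)
  have "compact ({0..R} \<times> {0..R})" by (intro compact_Times) auto
  then have "bounded Z" using *(4) bounded_subset compact_imp_bounded by blast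
  then show "compact Z" using *(2) by (simp add: compact_eq_bounded_closed)
qed

lemma not_in_zs_if_large:
  assumes "zero_region R Z" "ennreal M \<le> x \<or> ennreal M \<le> y" "R < M"
  shows "\<not> in_zs (x, y) Z"
proof
  assume "in_zs (x, y) Z"
  then have "in_zs (ennreal M, 0) Z \<or> in_zs (0, ennreal M) Z"
    using assms(2) in_zs_mono[OF zero_regionD(3)[OF assms(1)]] by (metis zero_le)
  then have "(M, 0) \<in> Z \<or> (0, M) \<in> Z"
    using assms(3) zero_regionD(1)[OF assms(1)] by (auto simp: in_zs_def)
  then show False using zero_regionD(4)[OF assms(1)] assms(3) by auto
qed

text \<open>Every column contains a full segment of length \<open>M > R\<close>, which already
  exceeds all heights in \<open>Z\<close>, so one further step fills the quadrant.\<close>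

lemma Espans_of_strip:
  assumes Z: "zero_region R Z" and M: "R < M" and A: "A \<subseteq> quadrant"
    and strip: "{0..} \<times> {0..M} \<subseteq> (ET Z f g ^^ n) A"
    and meas: "\<And>u. {s. (u, s) \<in> (ET Z f g ^^ n) A} \<in> sets borel"
  shows "Espans Z f g A"
proof -
  let ?B = "(ET Z f g ^^ n) A"
  have "(u, v) \<in> ET Z f g ?B" if uv: "0 \<le> u" "0 \<le> v" for u v
  proof -
    have "{0..M} \<subseteq> {s. (u, s) \<in> ?B}" using strip uv by auto
    then have "emeasure lebesgue {0..M} \<le> ecol (u, v) ?B"
      unfolding ecol_def using meas by (intro emeasure_mono) auto
    then have "ennreal M \<le> ecol (u, v) ?B" using M zero_regionD(1)[OF Z] by simp
    then have "ennreal M \<le> ecol (u, v) ?B + ennreal (g u)" by (simp add: add_increasing2)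
    then show ?thesis using not_in_zs_if_large[OF Z _ M] uv by (simp add: ET_iff)
  qed
  then have "quadrant \<subseteq> (ET Z f g ^^ Suc n) A" by (auto simp: quadrant_def)
  moreover have "(\<Union>n. (ET Z f g ^^ n) A) \<subseteq> quadrant"
    using ET_iter_nonneg[OF _ A] by (auto simp: quadrant_def)
  ultimately show ?thesis unfolding Espans_def by blast
qed

lemma adm_fun_step:
  assumes "0 \<le> c"
  shows "adm_fun (\<lambda>x. if x \<le> r then c else 0)"
proof -
  have "((\<lambda>x. if x \<le> r then c else 0) \<longlongrightarrow> (if x \<le> r then c else 0)) (at_left x)" for x :: real
  proof (cases "x \<le> r")
    case True
    then show ?thesis
      by (intro tendsto_eventually) (auto simp: eventually_at_left_field intro!: exI[of _ "x - 1"])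
  next
    case False
    then show ?thesis
      by (intro tendsto_eventually) (auto simp: eventually_at_left_field intro!: exI[of _ r])
  qed
  moreover have "\<exists>R. \<forall>x\<ge>R. (if x \<le> r then c else 0) = 0" by (intro exI[of _ "r + 1"]) auto
  ultimately show ?thesis using assms by (auto simp: adm_fun_def)
qed

lemma half_line_integral_step:
  assumes "0 \<le> c" "0 \<le> r"
  shows "half_line_integral (\<lambda>x. if x \<le> r then c else 0) = ennreal (c * r)"
proof -
  have "half_line_integral (\<lambda>x. if x \<le> r then c else 0) = (\<integral>\<^sup>+x. ennreal c * indicator {0..r} x \<partial>lborel)"
    unfolding half_line_integral_def by (intro nn_integral_cong) (auto split: split_indicator)
  then show ?thesis using assms by (simp add: nn_integral_cmult ennreal_mult)
qed

lemma adm_fun_zero: "adm_fun (\<lambda>_. 0)"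
  by (auto simp: adm_fun_def)

text \<open>Growth from a general \<open>A\<close> does not produce lower sets, so here the sections
  get their measurability from the plane.\<close>

lemma ET_borel:
  assumes Z: "closed Z" and A: "A \<in> sets borel" and f: "adm_fun f" and g: "adm_fun g"
  shows "ET Z f g A \<in> sets borel"
proof -
  define r where "r v = emeasure lborel {t. (t, v) \<in> A}" for v
  define c where "c u = emeasure lborel {s. (u, s) \<in> A}" for u
  define f' where "f' x = f x * indicator {0..} x" for x :: real
  define g' where "g' x = g x * indicator {0..} x" for x :: real
  have [measurable]: "r \<in> borel_measurable borel" "c \<in> borel_measurable borel"
    using section_measures[OF A] by (simp_all add: r_def[abs_def] c_def[abs_def])
  have [measurable]: "f' \<in> borel_measurable borel" "g' \<in> borel_measurable borel"
    using adm_fun_borel[OF f] adm_fun_borel[OF g] by (simp_all add: f'_def[abs_def] g'_def[abs_def])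
  have [measurable]: "Z \<in> sets (borel \<Otimes>\<^sub>M borel)" "A \<in> sets (borel \<Otimes>\<^sub>M borel)"
    unfolding borel_prod using Z A by auto
  let ?x = "\<lambda>p. r (snd p) + ennreal (f' (snd p))" and ?y = "\<lambda>p. c (fst p) + ennreal (g' (fst p))"
  have "{p \<in> space (borel \<Otimes>\<^sub>M borel). p \<in> A \<or> 0 \<le> fst p \<and> 0 \<le> snd p \<and>
      \<not> (?x p \<noteq> \<infinity> \<and> ?y p \<noteq> \<infinity> \<and> (enn2real (?x p), enn2real (?y p)) \<in> Z)} \<in> sets (borel \<Otimes>\<^sub>M borel)"
    by measurable
  also have "{p \<in> space (borel \<Otimes>\<^sub>M borel). p \<in> A \<or> 0 \<le> fst p \<and> 0 \<le> snd p \<and>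
      \<not> (?x p \<noteq> \<infinity> \<and> ?y p \<noteq> \<infinity> \<and> (enn2real (?x p), enn2real (?y p)) \<in> Z)} = ET Z f g A"
    using sections_borel[OF A]
    by (auto simp: space_pair_measure ET_iff in_zs_def erow_def ecol_def r_def c_def f'_def g'_def)
  finally show ?thesis unfolding borel_prod .
qed

lemma ET_iter_borel:
  assumes "closed Z" "A \<in> sets borel" "adm_fun f" "adm_fun g"
  shows "(ET Z f g ^^ n) A \<in> sets borel"
  by (induction n) (use assms in \<open>auto intro: ET_borel\<close>)

text \<open>A smaller zero-set blocks less, so growth is faster. The iterates have to be Borel
  because \<open>emeasure\<close> is 0 on nonmeasurable sets, and lengths would then not be
  monotone.\<close>

lemma Espans_antimono:
  assumes Z: "lower_set Z" "closed Z'" and sub: "Z' \<subseteq> Z" and A: "A \<in> sets borel" "A \<subseteq> quadrant"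
    and f: "adm_fun f" and g: "adm_fun g" and sp: "Espans Z f g A"
  shows "Espans Z' f g A"
proof -
  have "(ET Z f g ^^ n) A \<subseteq> (ET Z' f g ^^ n) A" for n
  proof (induction n)
    case (Suc n)
    let ?A = "(ET Z f g ^^ n) A" and ?B = "(ET Z' f g ^^ n) A"
    have B: "?B \<in> sets borel" by (rule ET_iter_borel[OF Z(2) A(1) f g])
    have r: "erow p ?A \<le> erow p ?B" for p
      unfolding erow_def using Suc sections_borel[OF B] by (intro emeasure_mono) auto
    have c: "ecol p ?A \<le> ecol p ?B" for p
      unfolding ecol_def using Suc sections_borel[OF B] by (intro emeasure_mono) auto
    have "(u, v) \<in> ET Z' f g ?B" if "(u, v) \<in> ET Z f g ?A" for u v
    proof -
      have "in_zs (erow (u, v) ?A + ennreal (f v), ecol (u, v) ?A + ennreal (g u)) Z"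
        if "in_zs (erow (u, v) ?B + ennreal (f v), ecol (u, v) ?B + ennreal (g u)) Z'"
      proof (rule in_zs_mono[OF Z(1)])
        show "in_zs (erow (u, v) ?B + ennreal (f v), ecol (u, v) ?B + ennreal (g u)) Z"
          using that sub by (auto simp: in_zs_def)
      qed (use r c in \<open>auto intro: add_right_mono\<close>)
      then show ?thesis using \<open>(u, v) \<in> ET Z f g ?A\<close> Suc unfolding ET_iff by blast
    qed
    then show ?case unfolding funpow.simps o_apply by (rule subrelI)
  qed simp
  then have "quadrant \<subseteq> (\<Union>n. (ET Z' f g ^^ n) A)"
    unfolding sp[unfolded Espans_def, symmetric] by (intro UN_mono order_refl)
  moreover have "(\<Union>n. (ET Z' f g ^^ n) A) \<subseteq> quadrant"
    using ET_iter_nonneg[OF _ A(2)] by (auto simp: quadrant_def)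
  ultimately show ?thesis unfolding Espans_def by blast
qed

text \<open>A row enhancement exceeding the width of \<open>Z\<close> fills a strip of height
  \<open>R + 1\<close> at once. This keeps the real infima in the costs from being taken over empty
  sets.\<close>

lemma thin_spanning_exists:
  assumes Z: "zero_region R Z"
  obtains f g where "adm_fun f" "adm_fun g" "Espans Z f g {}"
proof
  let ?f = "\<lambda>x. if x \<le> R + 1 then R + 1 else 0"
  show f: "adm_fun ?f" "adm_fun (\<lambda>_. 0)"
    using zero_regionD(1)[OF Z] by (auto intro: adm_fun_step adm_fun_zero)
  have low: "lower_set ((ET Z ?f (\<lambda>_. 0) ^^ 1) {})"
    using f by (intro lower_set_ET_iter zero_regionD(3)[OF Z]) (auto simp: adm_fun_def)
  show "Espans Z ?f (\<lambda>_. 0) {}"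
  proof (rule Espans_of_strip[OF Z, where n = 1 and M = "R + 1"])
    show "{0..} \<times> {0..R + 1} \<subseteq> (ET Z ?f (\<lambda>_. 0) ^^ 1) {}"
      using not_in_zs_if_large[OF Z, of "R + 1"] by (auto simp: ET_iff add_increasing)
  qed (use lower_set_sections_borel[OF low] in auto)
qed

subsection \<open>Comparison of the two costs\<close>

lemma I_bdd_le:
  assumes "compact A" "adm_fun f" "adm_fun g" "Espans Z f g A" "\<alpha> \<le> 1" "\<beta> \<le> 1"
  shows "I_bdd \<alpha> \<beta> Z \<le> measure lebesgue A + (1 - \<alpha>) * integral {0..} f + (1 - \<beta>) * integral {0..} g"
  unfolding I_bdd_def
  by (rule cInf_lower, use assms in blast)
    (rule bdd_belowI[of _ 0], use assms(5,6) adm_fun_integral(3) in fastforce)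

lemma I_bdd_ge:
  assumes "zero_region R Z"
    and "\<And>A f g. compact A \<Longrightarrow> adm_fun f \<Longrightarrow> adm_fun g \<Longrightarrow> Espans Z f g A \<Longrightarrow>
      c \<le> measure lebesgue A + (1 - \<alpha>) * integral {0..} f + (1 - \<beta>) * integral {0..} g"
  shows "c \<le> I_bdd \<alpha> \<beta> Z"
  unfolding I_bdd_def
proof (rule cInf_greatest)
  obtain f g where "adm_fun f" "adm_fun g" "Espans Z f g {}" using thin_spanning_exists[OF assms(1)] .
  then show "{measure lebesgue A + (1 - \<alpha>) * integral {0..} f + (1 - \<beta>) * integral {0..} g
       | A f g. compact A \<and> adm_fun f \<and> adm_fun g \<and> Espans Z f g A} \<noteq> {}"
    using compact_empty by blast
qed (use assms(2) in blast)

lemma gthin_bdd_le: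
  assumes "adm_fun f" "adm_fun g" "Espans Z f g {}"
  shows "gthin_bdd Z \<le> integral {0..} f + integral {0..} g"
  unfolding gthin_bdd_def
  by (rule cInf_lower, use assms in blast)
    (rule bdd_belowI[of _ 0], use adm_fun_integral(3) in fastforce)

lemma gthin_bdd_ge:
  assumes "zero_region R Z"
    and "\<And>f g. adm_fun f \<Longrightarrow> adm_fun g \<Longrightarrow> Espans Z f g {} \<Longrightarrow> c \<le> integral {0..} f + integral {0..} g"
  shows "c \<le> gthin_bdd Z"
  unfolding gthin_bdd_def
proof (rule cInf_greatest)
  obtain f g where "adm_fun f" "adm_fun g" "Espans Z f g {}" using thin_spanning_exists[OF assms(1)] .
  then show "{integral {0..} f + integral {0..} g | f g. adm_fun f \<and> adm_fun g \<and> Espans Z f g {}} \<noteq> {}"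
    by blast
qed (use assms(2) in blast)

lemma gthin_bdd_le_thinned:
  assumes "lower_set Z" "compact A" "adm_fun f" "adm_fun g" "Espans Z f g A"
  shows "gthin_bdd Z \<le> 2 * measure lebesgue A + integral {0..} f + integral {0..} g"
proof -
  obtain F G where "adm_fun F" "adm_fun G" "Espans Z F G {}"
    "integral {0..} F \<le> integral {0..} f + measure lebesgue A"
    "integral {0..} G \<le> integral {0..} g + measure lebesgue A"
    using thin_spanning[OF assms(1,5,2,3,4)] .
  then show ?thesis using gthin_bdd_le[of F G Z] by linarith
qed

text \<open>Makes the cost of a truncation monotone in its size, so that the limits defining
  \<open>Itilde\<close> exist.\<close>

lemma I_bdd_mono:
  assumes Z: "zero_region R Z" and Z': "zero_region R' Z'" and sub: "Z' \<subseteq> Z" and "\<alpha> \<le> 1" "\<beta> \<le> 1"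
  shows "I_bdd \<alpha> \<beta> Z' \<le> I_bdd \<alpha> \<beta> Z"
proof (rule I_bdd_ge[OF Z])
  fix A f g assume *: "compact A" "adm_fun f" "adm_fun g" "Espans Z f g A"
  have "Espans Z' f g A"
    by (rule Espans_antimono[OF zero_regionD(3)[OF Z] zero_regionD(2)[OF Z'] sub])
      (use * Espans_subset_quadrant in \<open>auto simp: borel_compact\<close>)
  then show "I_bdd \<alpha> \<beta> Z' \<le> measure lebesgue A + (1 - \<alpha>) * integral {0..} f + (1 - \<beta>) * integral {0..} g"
    using * assms by (intro I_bdd_le) auto
qed

lemma I_bdd_nonneg: "zero_region R Z \<Longrightarrow> \<alpha> \<le> 1 \<Longrightarrow> \<beta> \<le> 1 \<Longrightarrow> 0 \<le> I_bdd \<alpha> \<beta> Z"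
  by (rule I_bdd_ge) (auto simp: adm_fun_integral(3))

lemma I_bdd_le_zero:
  assumes Z: "zero_region R Z" and "0 \<le> \<alpha>" "\<alpha> \<le> 1"
  shows "I_bdd \<alpha> \<alpha> Z \<le> I_bdd 0 0 Z"
proof (rule I_bdd_ge[OF Z])
  fix A f g assume *: "compact A" "adm_fun f" "adm_fun g" "Espans Z f g A"
  have "(1 - \<alpha>) * integral {0..} f \<le> 1 * integral {0..} f" "(1 - \<alpha>) * integral {0..} g \<le> 1 * integral {0..} g"
    using assms * by (intro mult_right_mono; simp add: adm_fun_integral(3))+
  then show "I_bdd \<alpha> \<alpha> Z \<le> measure lebesgue A + (1 - 0) * integral {0..} f + (1 - 0) * integral {0..} g"
    using I_bdd_le[OF *, of \<alpha> \<alpha>] assms by simp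
qed

lemma I_bdd_ge_mix:
  assumes Z: "zero_region R Z" and \<alpha>: "0 \<le> \<alpha>" "\<alpha> \<le> 1 / 2"
  shows "(1 - 2 * \<alpha>) * I_bdd 0 0 Z + \<alpha> * gthin_bdd Z \<le> I_bdd \<alpha> \<alpha> Z"
proof (rule I_bdd_ge[OF Z])
  fix A f g assume *: "compact A" "adm_fun f" "adm_fun g" "Espans Z f g A"
  let ?a = "measure lebesgue A" and ?T = "integral {0..} f + integral {0..} g"
  have "(1 - 2 * \<alpha>) * I_bdd 0 0 Z \<le> (1 - 2 * \<alpha>) * (?a + ?T)"
    using I_bdd_le[OF *, of 0 0] \<alpha> by (intro mult_left_mono) auto
  moreover have "\<alpha> * gthin_bdd Z \<le> \<alpha> * (2 * ?a + ?T)"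
    using gthin_bdd_le_thinned[OF zero_regionD(3)[OF Z] *] \<alpha> by (intro mult_left_mono) auto
  ultimately show "(1 - 2 * \<alpha>) * I_bdd 0 0 Z + \<alpha> * gthin_bdd Z
      \<le> ?a + (1 - \<alpha>) * integral {0..} f + (1 - \<alpha>) * integral {0..} g"
    by (simp add: algebra_simps)
qed

lemma I_bdd_eq_thin:
  assumes Z: "zero_region R Z" and \<alpha>: "1 / 2 \<le> \<alpha>" "\<alpha> \<le> 1"
  shows "I_bdd \<alpha> \<alpha> Z = (1 - \<alpha>) * gthin_bdd Z"
proof (rule antisym)
  show "(1 - \<alpha>) * gthin_bdd Z \<le> I_bdd \<alpha> \<alpha> Z"
  proof (rule I_bdd_ge[OF Z])
    fix A f g assume *: "compact A" "adm_fun f" "adm_fun g" "Espans Z f g A"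
    let ?a = "measure lebesgue A" and ?T = "integral {0..} f + integral {0..} g"
    have "(1 - \<alpha>) * gthin_bdd Z \<le> (1 - \<alpha>) * (2 * ?a + ?T)"
      using gthin_bdd_le_thinned[OF zero_regionD(3)[OF Z] *] \<alpha> by (intro mult_left_mono) auto
    \<comment> \<open>Here \<open>\<alpha> \<ge> 1/2\<close> enters: two copies of the area at rate
      \<open>1 - \<alpha>\<close> cost no more than the area itself.\<close>
    moreover have "(2 - 2 * \<alpha>) * ?a \<le> 1 * ?a" using \<alpha> by (intro mult_right_mono) auto
    ultimately show "(1 - \<alpha>) * gthin_bdd Z
        \<le> ?a + (1 - \<alpha>) * integral {0..} f + (1 - \<alpha>) * integral {0..} g"
      by (simp add: algebra_simps)
  qed
  show "I_bdd \<alpha> \<alpha> Z \<le> (1 - \<alpha>) * gthin_bdd Z"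
  \<comment> \<open>Away from 1 the bound is divided by \<open>1 - \<alpha>\<close> to compare with
    each competitor of the infimum; at 1 every thin pair costs 0.\<close>
  proof (cases "\<alpha> = 1")
    case True
    obtain f g where "adm_fun f" "adm_fun g" "Espans Z f g {}" using thin_spanning_exists[OF Z] .
    then show ?thesis using I_bdd_le[of "{}" f g Z 1 1] True by simp
  next
    case False
    then have "I_bdd \<alpha> \<alpha> Z / (1 - \<alpha>) \<le> gthin_bdd Z"
    proof (intro gthin_bdd_ge[OF Z])
      fix f g assume "adm_fun f" "adm_fun g" "Espans Z f g {}"
      then show "I_bdd \<alpha> \<alpha> Z / (1 - \<alpha>) \<le> integral {0..} f + integral {0..} g"
        using I_bdd_le[of "{}" f g Z \<alpha> \<alpha>] \<alpha> False by (simp add: field_simps)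
    qed
    then show ?thesis using False \<alpha> by (simp add: field_simps)
  qed
qed

text \<open>At \<open>\<alpha> = 1/2\<close> the diagonal cost is exactly half the thin cost, and it
  does not exceed the cost at 0.\<close>

lemma gthin_bdd_le_twice:
  assumes Z: "zero_region R Z"
  shows "gthin_bdd Z \<le> 2 * I_bdd 0 0 Z"
  using I_bdd_eq_thin[OF Z, of "1 / 2"] I_bdd_le_zero[OF Z, of "1 / 2"] by simp

subsection \<open>One-sided costs\<close>

lemma area_le_integral:
  assumes f: "adm_fun f" and V: "V \<in> sets borel"
    and sub: "\<And>x y. (x, y) \<in> V \<Longrightarrow> 0 \<le> x \<and> 0 \<le> y \<and> x \<le> f y"
  shows "measure lebesgue V \<le> integral {0..} f"
proof -
  have "emeasure lborel V = (\<integral>\<^sup>+y. emeasure lborel {x. (x, y) \<in> V} \<partial>lborel)"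
    by (rule section_measures(3)[OF V, symmetric])
  also have "\<dots> \<le> half_line_integral f"
    unfolding half_line_integral_def
  proof (rule nn_integral_mono)
    fix y
    show "emeasure lborel {x. (x, y) \<in> V} \<le> ennreal (f y) * indicator {0..} y"
    proof (cases "0 \<le> y")
      case True
      have "emeasure lborel {x. (x, y) \<in> V} \<le> emeasure lborel {0..f y}"
        using sub by (intro emeasure_mono) auto
      then show ?thesis using True f by (simp add: adm_fun_def)
    next
      case False
      then have "{x. (x, y) \<in> V} = {}" using sub by auto
      then show ?thesis by simp
    qed
  qed
  finally have "emeasure lborel V \<le> ennreal (integral {0..} f)"
    by (simp add: adm_fun_integral(1)[OF f])
  then have "enn2real (emeasure lborel V) \<le> integral {0..} f"
    using adm_fun_integral(3)[OF f] by (simp add: enn2real_leI)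
  then show ?thesis using V by (simp add: measure_def)
qed

lemma adm_fun_mult_le_integral:
  assumes f: "adm_fun f" and s: "0 \<le> s"
  shows "s * f s \<le> integral {0..} f"
proof -
  have fs: "0 \<le> f s" using f s by (simp add: adm_fun_def)
  have "ennreal (f s * s) = half_line_integral (\<lambda>x. if x \<le> s then f s else 0)"
    using fs s by (simp add: half_line_integral_step)
  also have "\<dots> \<le> half_line_integral f"
    unfolding half_line_integral_def using f s
    by (intro nn_integral_mono) (auto simp: adm_fun_def intro!: ennreal_leI split: split_indicator)
  finally show ?thesis
    using adm_fun_integral[OF f] by (simp add: mult.commute)
qed

text \<open>By Markov \<open>g s \<le> s\<close>. If \<open>(s + x, s + y)\<close> is in
  \<open>Z\<close> and \<open>f y < x\<close>, then \<open>(s + f y, y + g s)\<close> lies below it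
  and violates the barrier; so \<open>Z\<close> translated by \<open>(-s, -s)\<close> and cut to the
  quadrant lies under the graph of \<open>f\<close>. The translation loses at most two strips of
  width \<open>s\<close> and length \<open>R\<close>.\<close>

lemma thin_integral_ge:
  assumes Z: "zero_region R Z" and f: "adm_fun f" and g: "adm_fun g" and sp: "Espans Z f g {}"
    and s: "0 < s" "integral {0..} g \<le> s\<^sup>2"
  shows "measure lebesgue Z - 2 * R * s \<le> integral {0..} f"
proof -
  have "s * g s \<le> s * s"
    using adm_fun_mult_le_integral[OF g, of s] s unfolding power2_eq_square by linarith
  then have gs: "g s \<le> s" using s by simp
  define V where "V = quadrant \<inter> (\<lambda>p. (s, s) + p) -` Z"
  have cV: "closed V"
    unfolding V_def quadrant_def
    by (intro closed_Int closed_Times closed_vimage zero_regionD(2)[OF Z] continuous_intros)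
  have "V \<subseteq> {0..R} \<times> {0..R}"
    using zero_regionD(4)[OF Z] s by (auto simp: V_def quadrant_def)
  then have bV: "bounded V" by (rule bounded_subset[OF bounded_Times[OF bounded_closed_interval bounded_closed_interval]])
  have V: "V \<in> lmeasurable" using cV bV by (simp add: lmeasurable_compact compact_eq_bounded_closed)
  have "measure lebesgue V \<le> integral {0..} f"
  proof (rule area_le_integral[OF f])
    show "V \<in> sets borel" using cV by simp
    fix x y assume xy: "(x, y) \<in> V"
    then have nn: "0 \<le> x" "0 \<le> y" and inZ: "(s + x, s + y) \<in> Z" by (auto simp: V_def quadrant_def)
    have "(s + f y, y + g s) \<notin> Z"
      by (rule Espans_empty_barrier[OF zero_regionD(3)[OF Z] sp])
        (use f g s nn in \<open>auto simp: adm_fun_def\<close>)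
    moreover have "0 \<le> f y" "0 \<le> g s" using f g s nn by (auto simp: adm_fun_def)
    ultimately show "0 \<le> x \<and> 0 \<le> y \<and> x \<le> f y"
      using lower_setD[OF zero_regionD(3)[OF Z] inZ, of "s + f y" "y + g s"] gs nn s by force
  qed
  moreover have "measure lebesgue Z \<le> measure lebesgue ((+) (s, s) ` V) + 2 * R * s"
  proof -
    let ?C = "cbox (0, 0) (s, R)" and ?D = "cbox (0, 0) (R, s)"
    have R: "0 \<le> R" by (rule zero_regionD(1)[OF Z])
    have "Z \<subseteq> (+) (s, s) ` V \<union> (?C \<union> ?D)"
    proof
      fix p assume p: "p \<in> Z"
      obtain x y where xy: "p = (x, y)" by (cases p)
      have b: "0 \<le> x" "x \<le> R" "0 \<le> y" "y \<le> R" using p zero_regionD(4)[OF Z] xy by auto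
      show "p \<in> (+) (s, s) ` V \<union> (?C \<union> ?D)"
      proof (cases "s \<le> x \<and> s \<le> y")
        case True
        then have "(x - s, y - s) \<in> V" using p xy by (auto simp: V_def quadrant_def)
        then have "(s, s) + (x - s, y - s) \<in> (+) (s, s) ` V" by (rule imageI)
        then show ?thesis using xy by simp
      next
        case False
        then show ?thesis using b xy by (auto simp: cbox_Pair_eq)
      qed
    qed
    moreover have tV: "(+) (s, s) ` V \<in> lmeasurable" using V by (rule measurable_translation)
    ultimately have "measure lebesgue Z \<le> measure lebesgue ((+) (s, s) ` V \<union> (?C \<union> ?D))"
      using zero_regionD(5)[OF Z]
      by (intro measure_mono_fmeasurable fmeasurable.Un) (auto simp: fmeasurableD lmeasurable_compact)
    also have "\<dots> \<le> measure lebesgue ((+) (s, s) ` V) + measure lebesgue (?C \<union> ?D)"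
      using tV by (intro measure_Un_le) auto
    also have "measure lebesgue (?C \<union> ?D) \<le> measure lebesgue ?C + measure lebesgue ?D"
      by (intro measure_Un_le) auto
    also have "measure lebesgue ?C + measure lebesgue ?D = 2 * R * s"
      using R s by (simp add: content_Pair)
    finally show ?thesis by simp
  qed
  ultimately show ?thesis by (simp add: measure_translation)
qed

text \<open>After thinning, the cost is at least \<open>(1 - \<alpha>)\<close> times the integral of
  \<open>F\<close> plus \<open>\<alpha>\<close> times that of \<open>G\<close>. With
  \<open>s^2\<close> the latter integral, this is at least
  \<open>(1 - \<alpha>) * (area - 2 * R * s) + \<alpha> * s^2\<close>, and minimising over
  \<open>s\<close> gives the bound.\<close>

lemma I_bdd_one_sided_ge:
  assumes Z: "zero_region R Z" and \<alpha>: "0 < \<alpha>" "\<alpha> < 1"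
  shows "(1 - \<alpha>) * (measure lebesgue Z - (1 - \<alpha>) * R\<^sup>2 / \<alpha>) \<le> I_bdd \<alpha> 0 Z"
proof (rule I_bdd_ge[OF Z])
  fix A f g assume *: "compact A" "adm_fun f" "adm_fun g" "Espans Z f g A"
  let ?a = "measure lebesgue A"
  obtain F G where FG: "adm_fun F" "adm_fun G" "Espans Z F G {}"
    and F: "integral {0..} F \<le> integral {0..} f + ?a"
    and G: "integral {0..} G \<le> integral {0..} g + ?a"
    using thin_spanning[OF zero_regionD(3)[OF Z] *(4,1,2,3)] .
  define s where "s = sqrt (integral {0..} G)"
  have s: "0 \<le> s" "s\<^sup>2 = integral {0..} G" using adm_fun_integral(3)[OF FG(2)] by (auto simp: s_def)
  have R: "0 \<le> R" by (rule zero_regionD(1)[OF Z])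
  have Fge: "measure lebesgue Z - 2 * R * s \<le> integral {0..} F"
  \<comment> \<open>The integral of \<open>G\<close> may vanish, while the shift in
    \<open>thin_integral_ge\<close> must be positive; hence the perturbation by
    \<open>d\<close>.\<close>
  proof (rule field_le_epsilon)
    fix e :: real assume e: "0 < e"
    define d where "d = e / (2 * R + 1)"
    have d: "0 < d" "2 * R * d \<le> e" using e R by (auto simp: d_def field_simps)
    have "s\<^sup>2 \<le> (s + d)\<^sup>2" using s d by (intro power_mono) auto
    then have "measure lebesgue Z - 2 * R * (s + d) \<le> integral {0..} F"
      using s d by (intro thin_integral_ge[OF Z FG]) auto
    then show "measure lebesgue Z - 2 * R * s \<le> integral {0..} F + e" using d by (simp add: algebra_simps)
  qed
  \<comment> \<open>The square is centred at the minimiser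
    \<open>s = (1 - \<alpha>) * R / \<alpha>\<close>.\<close>
  have "0 \<le> (\<alpha> * s - (1 - \<alpha>) * R)\<^sup>2 / \<alpha>" using \<alpha> by simp
  also have "\<dots> = \<alpha> * s\<^sup>2 - 2 * (1 - \<alpha>) * R * s + (1 - \<alpha>)\<^sup>2 * R\<^sup>2 / \<alpha>"
    using \<alpha> by (simp add: power2_eq_square field_simps)
  finally have sq: "2 * (1 - \<alpha>) * R * s - (1 - \<alpha>)\<^sup>2 * R\<^sup>2 / \<alpha> \<le> \<alpha> * s\<^sup>2" by simp
  have "(1 - \<alpha>) * (measure lebesgue Z - 2 * R * s) \<le> (1 - \<alpha>) * integral {0..} F"
    using Fge \<alpha> by (intro mult_left_mono) auto
  also have "\<dots> \<le> (1 - \<alpha>) * (integral {0..} f + ?a)" using F \<alpha> by (intro mult_left_mono) auto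
  finally have 1: "(1 - \<alpha>) * (measure lebesgue Z - 2 * R * s) \<le> (1 - \<alpha>) * (integral {0..} f + ?a)" .
  have "\<alpha> * s\<^sup>2 \<le> \<alpha> * (integral {0..} g + ?a)" using G \<alpha> s by (intro mult_left_mono) auto
  then have "\<alpha> * s\<^sup>2 \<le> \<alpha> * integral {0..} g + \<alpha> * ?a" by (simp only: distrib_left)
  moreover have "\<alpha> * integral {0..} g \<le> 1 * integral {0..} g"
    using \<alpha> adm_fun_integral(3)[OF *(3)] by (intro mult_right_mono) auto
  moreover have "(1 - \<alpha>) * (measure lebesgue Z - (1 - \<alpha>) * R\<^sup>2 / \<alpha>)
      = (1 - \<alpha>) * (measure lebesgue Z - 2 * R * s) + (2 * (1 - \<alpha>) * R * s - (1 - \<alpha>)\<^sup>2 * R\<^sup>2 / \<alpha>)"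
    by (simp add: power2_eq_square algebra_simps)
  moreover have "?a + (1 - \<alpha>) * integral {0..} f + (1 - 0) * integral {0..} g
      = (1 - \<alpha>) * (integral {0..} f + ?a) + \<alpha> * ?a + integral {0..} g"
    by (simp add: algebra_simps)
  ultimately show "(1 - \<alpha>) * (measure lebesgue Z - (1 - \<alpha>) * R\<^sup>2 / \<alpha>)
      \<le> ?a + (1 - \<alpha>) * integral {0..} f + (1 - 0) * integral {0..} g"
    using sq 1 by linarith
qed

lemma bump_zero: "0 \<le> R \<Longrightarrow> 0 \<le> K \<Longrightarrow> bump R K (\<lambda>_. 0)"
  by (simp add: bump_def)

text \<open>The row enhancement follows the boundary of \<open>Z\<close> with a delay of \<open>d\<close>, which lets the
  filled strip grow by \<open>d\<close> in each step.\<close>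

lemma one_sided_spanning:
  assumes Z: "zero_region R Z" and d: "0 < d"
  obtains f g where "adm_fun f" "adm_fun g" "Espans Z f g {}"
    "integral {0..} f \<le> measure lebesgue Z + d * (2 * R + 1)" "integral {0..} g \<le> 0"
proof -
  have R: "0 \<le> R" and low: "lower_set Z" and ZR: "Z \<subseteq> {0..R} \<times> {0..R}"
    using zero_regionD[OF Z] by auto
  \<comment> \<open>At height \<open>v\<close> the translate has the width of \<open>Z\<close> at
    height \<open>v - d\<close>; the rectangle supplies the full width \<open>R\<close> at heights
    up to \<open>d\<close>, at an extra area of \<open>R * d\<close>.\<close>
  define P where "P = cbox (0, 0) (R, d) \<union> (+) (0, d) ` Z"
  define S where "S v = {t. (t, v) \<in> P}" for v
  \<comment> \<open>The extra \<open>d\<close> puts \<open>F v\<close> strictly beyond the section: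
    as \<open>Z\<close> is closed, just reaching its boundary would not trigger growth. It costs
    \<open>d * (R + 1)\<close>, whence the total overhead \<open>d * (2 * R + 1)\<close>.\<close>
  define h where "h = (\<lambda>v. if v \<le> R + 1 then d else 0)"
  define R' where "R' = R + 1 + d"
  define F where "F = (\<lambda>v. h v * indicator {0..} v + measure lborel (S v))"
  have cP: "compact P"
    unfolding P_def by (intro compact_Un compact_cbox compact_translation zero_regionD(5)[OF Z])
  have Pb: "P \<in> sets borel" using cP by (simp add: borel_compact)
  have inP: "(t, v) \<in> P \<longleftrightarrow> 0 \<le> t \<and> t \<le> R \<and> 0 \<le> v \<and> v \<le> d \<or> (t, v - d) \<in> Z" for t v
  proof -
    have "(t, v) \<in> (+) (0, d) ` Z \<longleftrightarrow> (t, v - d) \<in> Z"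
      by (force simp: image_iff)
    then show ?thesis by (auto simp: P_def cbox_Pair_eq)
  qed
  have SP: "S v \<subseteq> {0..R'}" "R' < v \<Longrightarrow> S v = {}" "S v \<in> sets borel" for v
  proof -
    show "S v \<subseteq> {0..R'}" "R' < v \<Longrightarrow> S v = {}"
      using ZR R d by (auto simp: S_def inP R'_def)
    show "S v \<in> sets borel" unfolding S_def by (rule sections_borel(1)[OF Pb])
  qed
  have h: "adm_fun h" unfolding h_def using d by (intro adm_fun_step) simp
  have hR: "h x = 0" if "R' < x" for x using that d by (simp add: h_def R'_def)
  have h0: "h 0 + R' \<le> d + R'" using R by (simp add: h_def)
  have R': "0 \<le> R'" using R d by (simp add: R'_def)
  have meas: "(\<lambda>v. emeasure lborel (S v)) \<in> borel_measurable borel"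
    unfolding S_def by (rule section_measures(1)[OF Pb])
  note Fb = bump_add_sections[OF h hR h0 R' SP(1) SP(3) SP(2) meas, folded F_def]
  have "measure lebesgue P \<le> measure lebesgue (cbox (0, 0) (R, d)) + measure lebesgue ((+) (0, d) ` Z)"
    unfolding P_def
    using lmeasurable_compact[OF compact_translation[OF zero_regionD(5)[OF Z]]]
    by (intro measure_Un_le) auto
  also have "\<dots> = R * d + measure lebesgue Z"
    using R d by (simp add: content_Pair measure_translation)
  finally have areaP: "measure lebesgue P \<le> R * d + measure lebesgue Z" .
  have "emeasure lborel P = ennreal (measure lebesgue P)"
    using Pb emeasure_compact_finite[OF cP] by (simp add: measure_def less_top)
  then have "half_line_integral F \<le> ennreal (d * (R + 1)) + ennreal (measure lebesgue P)"
    using Fb(2) section_measures(3)[OF Pb] half_line_integral_step[of d "R + 1"] R d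
    by (simp add: S_def h_def)
  also have "\<dots> = ennreal (d * (R + 1) + measure lebesgue P)"
    using R d by simp
  also have "\<dots> \<le> ennreal (measure lebesgue Z + d * (2 * R + 1))"
    using areaP by (intro ennreal_leI) (simp add: algebra_simps)
  finally have intF: "half_line_integral F \<le> ennreal (measure lebesgue Z + d * (2 * R + 1))" .
  have finS: "emeasure lborel (S v) \<noteq> \<infinity>" for v
  proof -
    have "emeasure lborel (S v) \<le> emeasure lborel {0..R'}"
      using SP by (intro emeasure_mono) auto
    also have "\<dots> < \<infinity>" using R' by simp
    finally show ?thesis by simp
  qed
  have F_anti: "F y \<le> F x" if "0 \<le> x" "x \<le> y" for x y
  proof -
    have "S y \<subseteq> S x"
    proof
      fix t assume "t \<in> S y"
      then have t: "0 \<le> t \<and> t \<le> R \<and> 0 \<le> y \<and> y \<le> d \<or> (t, y - d) \<in> Z" by (simp add: S_def inP)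
      show "t \<in> S x"
      proof (cases "x \<le> d")
        case True
        then show ?thesis using t ZR that by (auto simp: S_def inP)
      next
        case False
        then have "(t, y - d) \<in> Z" using t that by auto
        then have "(t, x - d) \<in> Z"
          using lower_setD[OF low, of t "y - d" t "x - d"] lower_set_nonneg[OF low] that False by force
        then show ?thesis by (simp add: S_def inP)
      qed
    qed
    then have "measure lborel (S y) \<le> measure lborel (S x)"
      using SP finS[of x] by (intro measure_mono_fmeasurable) (auto simp: fmeasurable_def less_top)
    then show ?thesis using that d by (auto simp: F_def h_def)
  qed
  let ?B = "\<lambda>k. (ET Z F (\<lambda>_. 0) ^^ k) {}"
  have Blow: "lower_set (?B k)" for k
    by (rule lower_set_ET_iter[OF low]) (use F_anti in auto)
  have fill: "(u, v) \<in> ?B k" if "0 \<le> u" "0 \<le> v" "v \<le> R + 1" "v < real k * d" for k u v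
    using that
  proof (induction k arbitrary: u v)
    case (Suc k)
    \<comment> \<open>All heights below \<open>y\<close> are filled after \<open>k\<close> steps, so
      the column at \<open>u\<close> has length at least \<open>y\<close>, exactly the height at
      which \<open>F v\<close> was designed to escape from \<open>Z\<close>.\<close>
    define y where "y = max 0 (v - d)"
    have "{0..<y} \<subseteq> {s. (u, s) \<in> ?B k}"
    proof
      fix w assume w: "w \<in> {0..<y}"
      then have "0 \<le> w" "w \<le> R + 1" "w < real k * d"
        using Suc.prems d by (auto simp: y_def max_def algebra_simps split: if_splits)
      then show "w \<in> {s. (u, s) \<in> ?B k}" using Suc.IH Suc.prems by blast
    qed
    then have "emeasure lebesgue {0..<y} \<le> ecol (u, v) (?B k)"
      unfolding ecol_def using lower_set_sections_borel[OF Blow] by (intro emeasure_mono) auto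
    then have col: "ennreal y \<le> ecol (u, v) (?B k) + ennreal 0" by (simp add: y_def)
    have row: "ennreal (F v) \<le> erow (u, v) (?B k) + ennreal (F v)" by simp
    have Fv: "0 \<le> F v" using bump_bounds(1)[OF Fb(1)] Suc.prems by simp
    have "(F v, y) \<notin> Z"
    proof
      assume inZ: "(F v, y) \<in> Z"
      have "{0..F v} \<subseteq> S v"
      proof
        fix t assume t: "t \<in> {0..F v}"
        show "t \<in> S v"
        proof (cases "v \<le> d")
          case True
          then show ?thesis using t inZ ZR Suc.prems by (auto simp: S_def inP)
        next
          case False
          then have "(t, v - d) \<in> Z"
            using lower_setD[OF low inZ, of t "v - d"] t by (simp add: y_def)
          then show ?thesis by (simp add: S_def inP)
        qed
      qed
      then have "measure lborel {0..F v} \<le> measure lborel (S v)"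
        using SP finS[of v] by (intro measure_mono_fmeasurable) (auto simp: fmeasurable_def less_top)
      then have "F v \<le> measure lborel (S v)" using Fv by simp
      then show False using Suc.prems d by (simp add: F_def h_def)
    qed
    then have "\<not> in_zs (ennreal (F v), ennreal y) Z"
      using Fv by (subst in_zs_ennreal) (auto simp: y_def)
    then have "\<not> in_zs (erow (u, v) (?B k) + ennreal (F v), ecol (u, v) (?B k) + ennreal 0) Z"
      using in_zs_mono[OF low _ row col] by blast
    then show ?case using Suc.prems by (simp add: ET_iff)
  qed simp
  obtain k :: nat where k: "(R + 1) / d < real k" using reals_Archimedean2 by blast
  have "Espans Z F (\<lambda>_. 0) {}"
  proof (rule Espans_of_strip[OF Z, where n = k and M = "R + 1"])
    show "{0..} \<times> {0..R + 1} \<subseteq> ?B k"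
      using fill k d by (auto simp: field_simps)
  qed (use lower_set_sections_borel[OF Blow] in auto)
  \<comment> \<open>\<open>F\<close> has been shown to be nonincreasing but not left-continuous;
    rearranging with \<open>A = {}\<close> yields an admissible pair at no extra cost.\<close>
  moreover have b0: "bump R' (d + R') (\<lambda>_. 0)" using R' d by (intro bump_zero) auto
  ultimately have "Espans Z (rearr (d + R') F) (rearr (d + R') (\<lambda>_. 0)) {}"
    by (intro Espans_rearr[OF low _ _ _ Fb(1) b0]) (auto simp: erow_def ecol_def)
  moreover have "integral {0..} (rearr (d + R') F) \<le> measure lebesgue Z + d * (2 * R + 1)"
    using intF R d by (intro integral_rearr_le[OF Fb(1)]) auto
  \<comment> \<open>The rearranged zero function takes the cap as its value at 0, so it is its
    integral that vanishes, not the function.\<close>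
  moreover have "integral {0..} (rearr (d + R') (\<lambda>_. 0)) \<le> 0"
    by (intro integral_rearr_le[OF b0]) (auto simp: half_line_integral_def)
  ultimately show thesis
    using that adm_fun_rearr[OF Fb(1)] adm_fun_rearr[OF b0] by blast
qed

lemma I_bdd_one_sided_le:
  assumes Z: "zero_region R Z" and \<alpha>: "\<alpha> \<le> 1"
  shows "I_bdd \<alpha> 0 Z \<le> (1 - \<alpha>) * measure lebesgue Z"
proof (rule field_le_epsilon)
  fix e :: real assume e: "0 < e"
  have R: "0 \<le> R" by (rule zero_regionD(1)[OF Z])
  define c where "c = (1 - \<alpha>) * (2 * R + 1)"
  define d where "d = e / (c + 1)"
  have c: "0 \<le> c" using \<alpha> R by (simp add: c_def)
  then have d: "0 < d" "c * d \<le> e" using e by (auto simp: d_def field_simps)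
  obtain f g where fg: "adm_fun f" "adm_fun g" "Espans Z f g {}"
    and i: "integral {0..} f \<le> measure lebesgue Z + d * (2 * R + 1)" "integral {0..} g \<le> 0"
    using one_sided_spanning[OF Z d(1)] .
  have "I_bdd \<alpha> 0 Z \<le> (1 - \<alpha>) * integral {0..} f + integral {0..} g"
    using I_bdd_le[OF compact_empty fg, of \<alpha> 0] \<alpha> by simp
  also have "\<dots> \<le> (1 - \<alpha>) * (measure lebesgue Z + d * (2 * R + 1)) + 0"
    using i \<alpha> by (intro add_mono mult_left_mono) auto
  also have "\<dots> = (1 - \<alpha>) * measure lebesgue Z + c * d" by (simp add: c_def algebra_simps)
  finally show "I_bdd \<alpha> 0 Z \<le> (1 - \<alpha>) * measure lebesgue Z + e" using d by simp
qed

section \<open>L-shaped zero-sets\<close>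

definition Lshape :: "nat \<Rightarrow> (real \<times> real) set" where
  "Lshape n = {0..real n} \<times> {0..1} \<union> {0..1} \<times> {0..real n}"

lemma lower_set_Lshape: "lower_set (Lshape n)"
  by (auto simp: lower_set_def quadrant_def Lshape_def)

lemma closed_Lshape: "closed (Lshape n)"
  unfolding Lshape_def by (intro closed_Un closed_Times) auto

lemma zero_region_Lshape: "1 \<le> n \<Longrightarrow> zero_region (real n) (Lshape n)"
  by (auto simp: zero_region_def lower_set_Lshape closed_Lshape) (auto simp: Lshape_def)

lemma euclid_zero_set_Lshape:
  assumes n: "1 \<le> n"
  shows "euclid_zero_set (Lshape n)"
proof -
  have "Lshape n \<inter> {0<..} \<times> {0<..} = {0<..real n} \<times> {0<..1} \<union> {0<..1} \<times> {0<..real n}"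
    using n by (auto simp: Lshape_def)
  then have "closure (Lshape n \<inter> {0<..} \<times> {0<..}) = Lshape n"
    using n by (simp add: closure_Times Lshape_def)
  then show ?thesis
    using lower_set_Lshape[of n] closed_Lshape[of n]
    by (simp add: euclid_zero_set_def lower_set_def)
qed

text \<open>Cut the rectangle $[0,1] \times [0,n]$ along the graph of $1 - F$ and integrate the two parts
  in different orders.\<close>

lemma rectangle_split:
  assumes F: "adm_fun F" and G: "adm_fun G" and n: "0 \<le> n"
    and *: "\<And>x y. 0 \<le> x \<Longrightarrow> x \<le> 1 \<Longrightarrow> 0 \<le> y \<Longrightarrow> y \<le> n \<Longrightarrow> x + F y \<le> 1 \<Longrightarrow> n - y \<le> G x"
  shows "ennreal n \<le> (\<integral>\<^sup>+y. ennreal (min (F y) 1) * indicator {0..n} y \<partial>lborel)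
    + (\<integral>\<^sup>+x. ennreal (G x) * indicator {0..1} x \<partial>lborel)"
proof -
  define F' where "F' y = F y * indicator {0..} y" for y :: real
  have [measurable]: "F' \<in> borel_measurable borel"
    using adm_fun_borel[OF F] by (simp add: F'_def[abs_def])
  have F': "F' y = F y" if "0 \<le> y" for y using that by (simp add: F'_def)
  have nn: "0 \<le> F y" "0 \<le> G y" if "0 \<le> y" for y using F G that by (auto simp: adm_fun_def)
  define Q :: "(real \<times> real) set" where "Q = {0..1} \<times> {0..n}"
  define V where "V = {p \<in> space (borel \<Otimes>\<^sub>M borel). p \<in> Q \<and> fst p + F' (snd p) \<le> 1}"
  define W where "W = {p \<in> space (borel \<Otimes>\<^sub>M borel). p \<in> Q \<and> \<not> fst p + F' (snd p) \<le> 1}"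
  have [measurable]: "Q \<in> sets (borel \<Otimes>\<^sub>M borel)" by (simp add: Q_def)
  have "V \<in> sets (borel \<Otimes>\<^sub>M borel)" "W \<in> sets (borel \<Otimes>\<^sub>M borel)"
    unfolding V_def W_def by measurable
  then have VW: "V \<in> sets borel" "W \<in> sets borel" unfolding borel_prod .
  have QVW: "Q = W \<union> V" by (auto simp: V_def W_def space_pair_measure)
  have "Q = cbox (0, 0) (1, n)" by (simp add: Q_def cbox_Pair_eq)
  then have "emeasure lborel Q \<noteq> top" "measure lborel Q = n"
    using n emeasure_lborel_cbox_finite[of "(0, 0)" "(1, n)"] by (simp_all add: content_Pair less_top)
  then have "ennreal n = emeasure lborel Q" by (simp add: emeasure_eq_ennreal_measure)
  also have "emeasure lborel Q \<le> emeasure lborel W + emeasure lborel V"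
    unfolding QVW using VW by (intro emeasure_subadditive) auto
  also have "emeasure lborel W \<le> (\<integral>\<^sup>+y. ennreal (min (F y) 1) * indicator {0..n} y \<partial>lborel)"
    unfolding section_measures(3)[OF VW(2), symmetric]
  proof (rule nn_integral_mono)
    fix y
    show "emeasure lborel {t. (t, y) \<in> W} \<le> ennreal (min (F y) 1) * indicator {0..n} y"
    proof (cases "0 \<le> y \<and> y \<le> n")
      case True
      have "{t. (t, y) \<in> W} \<subseteq> {max 0 (1 - F y)..1}"
        using True by (auto simp: W_def Q_def F')
      then have "emeasure lborel {t. (t, y) \<in> W} \<le> emeasure lborel {max 0 (1 - F y)..1}"
        by (intro emeasure_mono) auto
      also have "\<dots> = ennreal (min (F y) 1)" using nn True by (auto simp: min_def max_def)
      finally show ?thesis using True by simp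
    next
      case False
      then have "{t. (t, y) \<in> W} = {}" by (auto simp: W_def Q_def)
      then show ?thesis by simp
    qed
  qed
  also have "emeasure lborel V \<le> (\<integral>\<^sup>+x. ennreal (G x) * indicator {0..1} x \<partial>lborel)"
    unfolding section_measures(4)[OF VW(1), symmetric]
  proof (rule nn_integral_mono)
    fix x
    show "emeasure lborel {s. (x, s) \<in> V} \<le> ennreal (G x) * indicator {0..1} x"
    proof (cases "0 \<le> x \<and> x \<le> 1")
      case True
      have "{s. (x, s) \<in> V} \<subseteq> {n - G x..n}"
        using True *[of x] by (fastforce simp: V_def Q_def F')
      then have "emeasure lborel {s. (x, s) \<in> V} \<le> emeasure lborel {n - G x..n}"
        by (intro emeasure_mono) auto
      also have "\<dots> = ennreal (G x)" using nn True by simp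
      finally show ?thesis using True by simp
    next
      case False
      then have "{s. (x, s) \<in> V} = {}" by (auto simp: V_def Q_def)
      then show ?thesis by simp
    qed
  qed
  finally show ?thesis by (simp add: add_mono)
qed

text \<open>On \<open>[0,1]\<close> the truncated copy costs at most 1; beyond it, only the
  truncated copy is present and is at most \<open>F\<close>. This overlap, once for each
  enhancement, is the 2 lost in \<open>2 * n - 2\<close>.\<close>

lemma split_integrals_le:
  assumes F: "adm_fun F"
  shows "(\<integral>\<^sup>+y. ennreal (min (F y) 1) * indicator {0..n} y \<partial>lborel)
      + (\<integral>\<^sup>+x. ennreal (F x) * indicator {0..1} x \<partial>lborel) \<le> ennreal (integral {0..} F + 1)"
proof -
  define F' where "F' y = F y * indicator {0..} y" for y :: real
  have [measurable]: "F' \<in> borel_measurable borel"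
    using adm_fun_borel[OF F] by (simp add: F'_def[abs_def])
  have F': "F' y = F y" if "0 \<le> y" for y using that by (simp add: F'_def)
  have nn: "0 \<le> F y" if "0 \<le> y" for y using F that by (auto simp: adm_fun_def)
  have "(\<integral>\<^sup>+y. ennreal (min (F y) 1) * indicator {0..n} y \<partial>lborel)
      + (\<integral>\<^sup>+x. ennreal (F x) * indicator {0..1} x \<partial>lborel)
    = (\<integral>\<^sup>+y. ennreal (min (F' y) 1) * indicator {0..n} y \<partial>lborel)
      + (\<integral>\<^sup>+x. ennreal (F' x) * indicator {0..1} x \<partial>lborel)"
    by (intro arg_cong2[where f = "(+)"] nn_integral_cong) (auto simp: F' split: split_indicator)
  also have "\<dots> = (\<integral>\<^sup>+y. ennreal (min (F' y) 1) * indicator {0..n} y + ennreal (F' y) * indicator {0..1} y \<partial>lborel)"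
    by (rule nn_integral_add[symmetric]) measurable
  also have "\<dots> \<le> (\<integral>\<^sup>+y. ennreal (F' y) * indicator {0..} y + indicator {0..1} y \<partial>lborel)"
    using nn F'
    by (intro nn_integral_mono)
      (auto simp: min_def add.commute intro!: ennreal_leI add_mono split: split_indicator)
  also have "\<dots> = (\<integral>\<^sup>+y. ennreal (F' y) * indicator {0..} y \<partial>lborel) + 1"
    by (subst nn_integral_add) auto
  also have "(\<integral>\<^sup>+y. ennreal (F' y) * indicator {0..} y \<partial>lborel) = half_line_integral F"
    unfolding half_line_integral_def by (intro nn_integral_cong) (auto simp: F' split: split_indicator)
  also have "half_line_integral F + 1 = ennreal (integral {0..} F + 1)"
    using adm_fun_integral[OF F] by simp
  finally show ?thesis .
qed

lemma gthin_bdd_Lshape_ge: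
  assumes n: "1 \<le> n"
  shows "2 * real n - 2 \<le> gthin_bdd (Lshape n)"
proof (rule gthin_bdd_ge[OF zero_region_Lshape[OF n]])
  fix F G assume F: "adm_fun F" and G: "adm_fun G" and sp: "Espans (Lshape n) F G {}"
  have barrier: "(x + F y, y + G x) \<notin> Lshape n" if "0 \<le> x" "0 \<le> y" for x y
    by (rule Espans_empty_barrier[OF lower_set_Lshape sp]) (use F G that in \<open>auto simp: adm_fun_def\<close>)
  have nn: "0 \<le> F y" "0 \<le> G y" if "0 \<le> y" for y using F G that by (auto simp: adm_fun_def)
  \<comment> \<open>With first coordinate at most 1, the barrier point can leave the L only above
    the top of its vertical arm.\<close>
  have 1: "real n - y \<le> G x" if "0 \<le> x" "x \<le> 1" "0 \<le> y" "y \<le> real n" "x + F y \<le> 1" for x y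
    using barrier[of x y] nn[of x] nn[of y] that by (auto simp: Lshape_def)
  have 2: "real n - y \<le> F x" if "0 \<le> x" "x \<le> 1" "0 \<le> y" "y \<le> real n" "x + G y \<le> 1" for x y
    using barrier[of y x] nn[of x] nn[of y] that by (auto simp: Lshape_def)
  let ?m = "\<lambda>F. (\<integral>\<^sup>+y. ennreal (min (F y) 1) * indicator {0..real n} y \<partial>lborel)"
    and ?i = "\<lambda>F. (\<integral>\<^sup>+x. ennreal (F x) * indicator {0..1} x \<partial>lborel)"
  have "ennreal (real n) + ennreal (real n) \<le> (?m F + ?i G) + (?m G + ?i F)"
    by (intro add_mono rectangle_split F G 1 2) auto
  \<comment> \<open>Each arm is paid for by a truncated copy of one function and the initial part of
    the other; regrouping by function lets the two arms together use each integral essentially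
    once.\<close>
  also have "\<dots> = (?m F + ?i F) + (?m G + ?i G)" by (simp add: ac_simps)
  also have "\<dots> \<le> ennreal (integral {0..} F + 1) + ennreal (integral {0..} G + 1)"
    by (intro add_mono split_integrals_le F G)
  also have "\<dots> = ennreal ((integral {0..} F + 1) + (integral {0..} G + 1))"
    by (rule ennreal_plus[symmetric]) (use adm_fun_integral(3)[OF F] adm_fun_integral(3)[OF G] in auto)
  also have "ennreal (real n) + ennreal (real n) = ennreal (real n + real n)"
    by (rule ennreal_plus[symmetric]) auto
  finally have "ennreal (real n + real n) \<le> ennreal ((integral {0..} F + 1) + (integral {0..} G + 1))" .
  then have "real n + real n \<le> (integral {0..} F + 1) + (integral {0..} G + 1)"
    using adm_fun_integral(3)[OF F] adm_fun_integral(3)[OF G] by (subst (asm) ennreal_le_iff) auto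
  then show "2 * real n - 2 \<le> integral {0..} F + integral {0..} G" by simp
qed

text \<open>A diagonal chain of \<open>n\<close> squares of side \<open>r > 1\<close> gives every
  row and column of \<open>[0, n * r]\<close> length at least \<open>r\<close> in both directions,
  which is outside the L. Its area is \<open>n * r^2\<close>, and \<open>r\<close> tends to
  1.\<close>

lemma I_bdd_Lshape_le:
  assumes n: "1 \<le> n"
  shows "I_bdd 0 0 (Lshape n) \<le> real n"
proof -
  have bound: "I_bdd 0 0 (Lshape n) \<le> real n * r\<^sup>2" if r: "1 < r" for r
  proof -
    define C where "C k = cbox (real k * r, real k * r) (real (Suc k) * r, real (Suc k) * r)" for k
    define A where "A = (\<Union>k<n. C k)"
    define M where "M = real n * r"
    have M: "real n < M" using n r by (simp add: M_def)
    have C: "(u, v) \<in> C k \<longleftrightarrow> u \<in> {real k * r..real (Suc k) * r} \<and> v \<in> {real k * r..real (Suc k) * r}" for u v k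
      by (simp add: C_def cbox_Pair_eq)
    have cA: "compact A" unfolding A_def C_def by (intro compact_UN) auto
    have Ab: "A \<in> sets borel" using cA by (simp add: borel_compact)
    have Aq: "A \<subseteq> quadrant"
    proof
      fix p assume "p \<in> A"
      then obtain k where "p \<in> C k" by (auto simp: A_def)
      then have "real k * r \<le> fst p" "real k * r \<le> snd p" using C[of "fst p" "snd p" k] by auto
      moreover have "0 \<le> real k * r" using r by simp
      ultimately show "p \<in> quadrant" unfolding quadrant_def by (cases p) auto
    qed
    let ?z = "\<lambda>_::real. 0::real"
    let ?B = "\<lambda>k. (ET (Lshape n) ?z ?z ^^ k) A"
    have Bb: "?B k \<in> sets borel" for k
      by (rule ET_iter_borel[OF closed_Lshape Ab adm_fun_zero adm_fun_zero])
    have block: "\<exists>k<n. v \<in> {real k * r..real (Suc k) * r}" if v: "0 \<le> v" "v \<le> M" for v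
    \<comment> \<open>At the right end point the floor would name the block with index
      \<open>n\<close>, one too many; the closed last block contains it.\<close>
    proof (cases "v = M")
      case True
      then show ?thesis using n r by (intro exI[of _ "n - 1"]) (auto simp: M_def of_nat_diff)
    next
      case False
      define k where "k = nat \<lfloor>v / r\<rfloor>"
      have "real k \<le> v / r" "v / r < real k + 1" using v r by (auto simp: k_def)
      then have k: "real k * r \<le> v" "v \<le> real (Suc k) * r" using r by (auto simp: field_simps)
      have "real k * r < real n * r" using k(1) False v by (simp add: M_def)
      then have "k < n" using r by simp
      then show ?thesis using k by auto
    qed
    have fill: "(u, v) \<in> ?B 1" if uv: "0 \<le> u" "u \<le> M" "0 \<le> v" "v \<le> M" for u v
    proof -
      obtain k where k: "k < n" "v \<in> {real k * r..real (Suc k) * r}" using block[of v] uv by auto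
      obtain l where l: "l < n" "u \<in> {real l * r..real (Suc l) * r}" using block[of u] uv by auto
      have "{real k * r..real (Suc k) * r} \<subseteq> {t. (t, v) \<in> A}"
        using k C unfolding A_def by blast
      then have "emeasure lebesgue {real k * r..real (Suc k) * r} \<le> erow (u, v) A"
        unfolding erow_def using sections_borel[OF Ab] by (intro emeasure_mono) auto
      then have row: "ennreal r \<le> erow (u, v) A + ennreal 0" using r by (simp add: algebra_simps)
      have "{real l * r..real (Suc l) * r} \<subseteq> {s. (u, s) \<in> A}"
        using l C unfolding A_def by blast
      then have "emeasure lebesgue {real l * r..real (Suc l) * r} \<le> ecol (u, v) A"
        unfolding ecol_def using sections_borel[OF Ab] by (intro emeasure_mono) auto
      then have col: "ennreal r \<le> ecol (u, v) A + ennreal 0" using r by (simp add: algebra_simps)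
      \<comment> \<open>The corner \<open>(1, 1)\<close> belongs to the L, so unit blocks would not
        suffice and \<open>r > 1\<close> has to be strict.\<close>
      have "\<not> in_zs (ennreal r, ennreal r) (Lshape n)"
        using r by (subst in_zs_ennreal) (auto simp: Lshape_def)
      then have "\<not> in_zs (erow (u, v) A + ennreal 0, ecol (u, v) A + ennreal 0) (Lshape n)"
        using in_zs_mono[OF lower_set_Lshape _ row col] by blast
      then show ?thesis using uv by (simp add: ET_iff)
    qed
    \<comment> \<open>The first step fills the square of side \<open>M > n\<close>, and the second
      extends it along rows to an infinite strip.\<close>
    have "Espans (Lshape n) ?z ?z A"
    proof (rule Espans_of_strip[OF zero_region_Lshape[OF n] M Aq, where n = 2])
      show "{0..} \<times> {0..M} \<subseteq> ?B 2"
      proof (rule subrelI)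
        fix u v :: real assume uv: "(u, v) \<in> {0..} \<times> {0..M}"
        have "{0..M} \<subseteq> {t. (t, v) \<in> ?B 1}" using fill uv by auto
        then have "emeasure lebesgue {0..M} \<le> erow (u, v) (?B 1)"
          unfolding erow_def using sections_borel(1)[OF Bb[of 1]] by (intro emeasure_mono) auto
        then have "ennreal M \<le> erow (u, v) (?B 1) + ennreal 0" using M by simp
        then have "(u, v) \<in> ET (Lshape n) ?z ?z (?B 1)"
          using not_in_zs_if_large[OF zero_region_Lshape[OF n] _ M] uv unfolding ET_iff by auto
        then show "(u, v) \<in> ?B 2" by (simp add: numeral_2_eq_2)
      qed
    qed (use sections_borel[OF Bb] in auto)
    then have "I_bdd 0 0 (Lshape n) \<le> measure lebesgue A"
      using I_bdd_le[OF cA adm_fun_zero adm_fun_zero, of "Lshape n" 0 0] by simp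
    also have "\<dots> \<le> (\<Sum>k<n. measure lebesgue (C k))"
      unfolding A_def by (rule measure_UNION_le) (auto simp: C_def)
    also have "\<dots> = (\<Sum>k<n. r\<^sup>2)"
      using r by (intro sum.cong) (auto simp: C_def content_Pair algebra_simps power2_eq_square)
    finally show ?thesis by simp
  qed
  have "((\<lambda>r. real n * r\<^sup>2) \<longlongrightarrow> real n * 1\<^sup>2) (at_right 1)" by (intro tendsto_intros)
  moreover have "eventually (\<lambda>r. I_bdd 0 0 (Lshape n) \<le> real n * r\<^sup>2) (at_right 1)"
    using bound by (auto simp: eventually_at_right_field intro!: exI[of _ 2])
  ultimately show ?thesis
    using tendsto_lowerbound[of "\<lambda>r. real n * r\<^sup>2" "real n" "at_right 1"] by simp
qed

section \<open>Passing to the limit\<close>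

lemma zero_region_truncate:
  assumes Z: "euclid_zero_set Z" and R: "0 \<le> R"
  shows "zero_region R (Z \<inter> ({0..R} \<times> {0..R}))"
proof -
  have cl: "closed Z" and q: "Z \<subseteq> quadrant"
    and down: "\<And>a b. (a, b) \<in> Z \<Longrightarrow> {0..a} \<times> {0..b} \<subseteq> Z"
    using Z unfolding euclid_zero_set_def by blast+
  have "closed (Z \<inter> ({0..R} \<times> {0..R}))" using cl by (intro closed_Int closed_Times) auto
  moreover have "lower_set (Z \<inter> ({0..R} \<times> {0..R}))"
    unfolding lower_set_def
  proof (intro conjI allI impI)
    fix a b assume "(a, b) \<in> Z \<inter> ({0..R} \<times> {0..R})"
    then show "{0..a} \<times> {0..b} \<subseteq> Z \<inter> ({0..R} \<times> {0..R})" using down[of a b] by auto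
  qed (use q in auto)
  ultimately show ?thesis using R by (simp add: zero_region_def)
qed

lemma tendsto_SUP_at_top:
  fixes \<phi> :: "real \<Rightarrow> ereal"
  assumes mono: "\<And>x y. 0 \<le> x \<Longrightarrow> x \<le> y \<Longrightarrow> \<phi> x \<le> \<phi> y"
  shows "(\<phi> \<longlongrightarrow> (SUP x\<in>{0..}. \<phi> x)) at_top"
proof (rule order_tendstoI)
  fix a assume "a < (SUP x\<in>{0..}. \<phi> x)"
  then obtain x where "0 \<le> x" "a < \<phi> x" by (auto simp: less_SUP_iff)
  then show "eventually (\<lambda>x. a < \<phi> x) at_top"
    unfolding eventually_at_top_linorder using mono by (meson order.strict_trans2)
next
  fix a assume a: "(SUP x\<in>{0..}. \<phi> x) < a"
  have "\<phi> x < a" if "0 \<le> x" for x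
    using SUP_upper[of x "{0..}" \<phi>] that a by auto
  then show "eventually (\<lambda>x. \<phi> x < a) at_top"
    unfolding eventually_at_top_linorder by blast
qed

context
  fixes Z :: "(real \<times> real) set"
  assumes Z: "euclid_zero_set Z"
begin

abbreviation (input) trunc :: "real \<Rightarrow> (real \<times> real) set" where
  "trunc R \<equiv> Z \<inter> ({0..R} \<times> {0..R})"

lemma I_bdd_trunc_mono:
  assumes "\<alpha> \<le> 1" "\<beta> \<le> 1" "0 \<le> x" "x \<le> y"
  shows "I_bdd \<alpha> \<beta> (trunc x) \<le> I_bdd \<alpha> \<beta> (trunc y)"
  by (rule I_bdd_mono[OF zero_region_truncate[OF Z, of y] zero_region_truncate[OF Z, of x]]) (use assms in auto)

text \<open>Monotonicity in \<open>R\<close> guarantees convergence, so \<open>Lim\<close> denotes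
  the actual limit; as a supremum it can be bounded below by any single truncation.\<close>

lemma Itilde_eq_SUP:
  assumes "\<alpha> \<le> 1" "\<beta> \<le> 1"
  shows "Itilde \<alpha> \<beta> Z = (SUP R\<in>{0..}. ereal (I_bdd \<alpha> \<beta> (trunc R)))"
  unfolding Itilde_def
  using assms by (intro tendsto_Lim tendsto_SUP_at_top) (auto intro: I_bdd_trunc_mono)

lemma Itilde_tendsto:
  assumes "\<alpha> \<le> 1" "\<beta> \<le> 1"
  shows "((\<lambda>R. ereal (I_bdd \<alpha> \<beta> (trunc R))) \<longlongrightarrow> Itilde \<alpha> \<beta> Z) at_top"
  unfolding Itilde_eq_SUP[OF assms]
  using assms by (intro tendsto_SUP_at_top) (auto intro: I_bdd_trunc_mono)

lemma Itilde_ge: "\<alpha> \<le> 1 \<Longrightarrow> \<beta> \<le> 1 \<Longrightarrow> 0 \<le> R \<Longrightarrow> ereal (I_bdd \<alpha> \<beta> (trunc R)) \<le> Itilde \<alpha> \<beta> Z"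
  by (subst Itilde_eq_SUP) (auto intro: SUP_upper)

lemma Itilde_nonneg: "\<alpha> \<le> 1 \<Longrightarrow> \<beta> \<le> 1 \<Longrightarrow> 0 \<le> Itilde \<alpha> \<beta> Z"
  using Itilde_ge[of \<alpha> \<beta> 0] I_bdd_nonneg[OF zero_region_truncate[OF Z], of 0 \<alpha> \<beta>]
  by (metis ereal_less_eq(5) order.refl order.trans)

lemma gamma_thin_tendsto: "((\<lambda>R. ereal (gthin_bdd (trunc R))) \<longlongrightarrow> gamma_thin Z) at_top"
proof -
  \<comment> \<open>Writing the thin cost as a diagonal cost at \<open>1/2\<close> transfers
    monotonicity in \<open>R\<close> to it.\<close>
  have eq: "gthin_bdd (trunc R) = 2 * I_bdd (1 / 2) (1 / 2) (trunc R)" if "0 \<le> R" for R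
    using I_bdd_eq_thin[OF zero_region_truncate[OF Z that], of "1 / 2"] by simp
  have lim: "((\<lambda>R. ereal (gthin_bdd (trunc R))) \<longlongrightarrow> (SUP R\<in>{0..}. ereal (gthin_bdd (trunc R)))) at_top"
    by (rule tendsto_SUP_at_top) (use I_bdd_trunc_mono in \<open>auto simp: eq\<close>)
  show ?thesis
    using lim unfolding gamma_thin_def tendsto_Lim[OF trivial_limit_at_top_linorder lim] .
qed

lemma Itilde_eq_thin:
  assumes \<alpha>: "1 / 2 \<le> \<alpha>" "\<alpha> \<le> 1"
  shows "Itilde \<alpha> \<alpha> Z = ereal (1 - \<alpha>) * gamma_thin Z"
proof (rule tendsto_unique[OF trivial_limit_at_top_linorder])
  show "((\<lambda>R. ereal (I_bdd \<alpha> \<alpha> (trunc R))) \<longlongrightarrow> Itilde \<alpha> \<alpha> Z) at_top"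
    using \<alpha> by (intro Itilde_tendsto) auto
  have "((\<lambda>R. ereal (1 - \<alpha>) * ereal (gthin_bdd (trunc R))) \<longlongrightarrow> ereal (1 - \<alpha>) * gamma_thin Z) at_top"
    by (intro tendsto_cmult_ereal gamma_thin_tendsto) simp
  moreover have "eventually (\<lambda>R. ereal (1 - \<alpha>) * ereal (gthin_bdd (trunc R)) = ereal (I_bdd \<alpha> \<alpha> (trunc R))) at_top"
    using eventually_ge_at_top[of 0]
    by eventually_elim (use \<alpha> I_bdd_eq_thin[OF zero_region_truncate[OF Z]] in simp)
  ultimately show "((\<lambda>R. ereal (I_bdd \<alpha> \<alpha> (trunc R))) \<longlongrightarrow> ereal (1 - \<alpha>) * gamma_thin Z) at_top"
    by (rule Lim_transform_eventually)
qed

lemma Itilde_le_mult_gamma: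
  assumes \<alpha>: "0 \<le> \<alpha>" "\<alpha> \<le> 1" and c: "0 \<le> c"
    and le: "\<And>R. 0 \<le> R \<Longrightarrow> I_bdd \<alpha> \<alpha> (trunc R) \<le> c * I_bdd 0 0 (trunc R)"
  shows "Itilde \<alpha> \<alpha> Z / gamma_tilde Z \<le> ereal c"
proof -
  have x: "0 \<le> Itilde \<alpha> \<alpha> Z" and y: "0 \<le> gamma_tilde Z"
    using \<alpha> by (auto simp: gamma_tilde_def Itilde_nonneg)
  have "((\<lambda>R. ereal c * ereal (I_bdd 0 0 (trunc R))) \<longlongrightarrow> ereal c * gamma_tilde Z) at_top"
    unfolding gamma_tilde_def by (intro tendsto_cmult_ereal Itilde_tendsto) auto
  moreover have "((\<lambda>R. ereal (I_bdd \<alpha> \<alpha> (trunc R))) \<longlongrightarrow> Itilde \<alpha> \<alpha> Z) at_top"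
    using \<alpha> by (intro Itilde_tendsto) auto
  moreover have "eventually (\<lambda>R. ereal (I_bdd \<alpha> \<alpha> (trunc R)) \<le> ereal c * ereal (I_bdd 0 0 (trunc R))) at_top"
    using eventually_ge_at_top[of 0] by eventually_elim (use le in simp)
  ultimately have "Itilde \<alpha> \<alpha> Z \<le> ereal c * gamma_tilde Z"
    by (intro tendsto_le[OF trivial_limit_at_top_linorder])
  \<comment> \<open>Degenerate quotients are harmless in \<open>ereal\<close>: division by
    \<open>\<infinity>\<close> gives 0, and \<open>gamma_tilde Z = 0\<close> forces a zero
    numerator, with \<open>0 / 0 = 0\<close>.\<close>
  then show ?thesis
    using x y c
    by (cases "Itilde \<alpha> \<alpha> Z"; cases "gamma_tilde Z")
      (auto simp: divide_simps split: if_splits)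
qed

lemma tendsto_measure_trunc:
  assumes fin: "emeasure lebesgue Z < \<infinity>"
  shows "(\<lambda>n. measure lebesgue (trunc (real n))) \<longlonglongrightarrow> measure lebesgue Z"
proof -
  have cl: "closed Z" and q: "Z \<subseteq> quadrant" using Z unfolding euclid_zero_set_def by blast+
  have "(\<Union>n. trunc (real n)) = Z"
  proof (intro equalityI subsetI)
    fix p assume p: "p \<in> Z"
    obtain n :: nat where "max (fst p) (snd p) \<le> real n" using real_arch_simple by blast
    then have "p \<in> trunc (real n)" using p q by (cases p) (auto simp: quadrant_def)
    then show "p \<in> (\<Union>n. trunc (real n))" by blast
  qed auto
  moreover have "(\<lambda>n. measure lebesgue (trunc (real n))) \<longlonglongrightarrow> measure lebesgue (\<Union>n. trunc (real n))"
  proof (rule Lim_measure_incseq)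
    show "range (\<lambda>n. trunc (real n)) \<subseteq> sets lebesgue"
      using zero_regionD(2)[OF zero_region_truncate[OF Z]] by (auto simp: borel_closed)
    show "incseq (\<lambda>n. trunc (real n))" by (auto simp: incseq_def)
    show "emeasure lebesgue (\<Union>n. trunc (real n)) \<noteq> \<infinity>" using fin calculation by simp
  qed
  ultimately show ?thesis by simp
qed

section \<open>The limits as \<open>\<alpha>\<close> tends to 1 for a fixed zero-set\<close>

text \<open>The upper bound is uniform over truncations. The lower bound has error
  \<open>(1 - \<alpha>) * R^2 / \<alpha>\<close>, so a truncation carrying almost all the area is
  chosen first and only then does \<open>\<alpha>\<close> tend to 1.\<close>

lemma one_sided_limit:
  assumes fin: "emeasure lebesgue Z < \<infinity>"
  shows "((\<lambda>\<alpha>. Itilde \<alpha> 0 Z / ereal (1 - \<alpha>)) \<longlongrightarrow> ereal (measure lebesgue Z)) (at_left 1)"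
proof -
  have Zm: "Z \<in> lmeasurable"
    using Z fin by (auto simp: euclid_zero_set_def fmeasurable_def borel_closed)
  have upper: "Itilde \<alpha> 0 Z / ereal (1 - \<alpha>) \<le> ereal (measure lebesgue Z)" if \<alpha>: "0 < \<alpha>" "\<alpha> < 1" for \<alpha>
  proof -
    have "Itilde \<alpha> 0 Z \<le> ereal ((1 - \<alpha>) * measure lebesgue Z)"
    proof (subst Itilde_eq_SUP)
      show "(SUP R\<in>{0..}. ereal (I_bdd \<alpha> 0 (trunc R))) \<le> ereal ((1 - \<alpha>) * measure lebesgue Z)"
      proof (rule SUP_least)
        fix R :: real assume "R \<in> {0..}"
        then have zr: "zero_region R (trunc R)" by (simp add: zero_region_truncate[OF Z])
        have "measure lebesgue (trunc R) \<le> measure lebesgue Z"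
          using Zm zero_regionD(2)[OF zr] by (intro measure_mono_fmeasurable) (auto simp: borel_closed)
        then have "(1 - \<alpha>) * measure lebesgue (trunc R) \<le> (1 - \<alpha>) * measure lebesgue Z"
          using \<alpha> by (intro mult_left_mono) auto
        then have "I_bdd \<alpha> 0 (trunc R) \<le> (1 - \<alpha>) * measure lebesgue Z"
          using I_bdd_one_sided_le[OF zr, of \<alpha>] \<alpha> by linarith
        then show "ereal (I_bdd \<alpha> 0 (trunc R)) \<le> ereal ((1 - \<alpha>) * measure lebesgue Z)" by simp
      qed
    qed (use \<alpha> in auto)
    then show ?thesis using \<alpha> by (cases "Itilde \<alpha> 0 Z") (auto simp: field_simps)
  qed
  have lower: "ereal (measure lebesgue (trunc R) - (1 - \<alpha>) * R\<^sup>2 / \<alpha>) \<le> Itilde \<alpha> 0 Z / ereal (1 - \<alpha>)"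
    if \<alpha>: "0 < \<alpha>" "\<alpha> < 1" and R: "0 \<le> R" for \<alpha> R
  proof -
    have "ereal ((1 - \<alpha>) * (measure lebesgue (trunc R) - (1 - \<alpha>) * R\<^sup>2 / \<alpha>)) \<le> ereal (I_bdd \<alpha> 0 (trunc R))"
      using I_bdd_one_sided_ge[OF zero_region_truncate[OF Z R] \<alpha>] by simp
    also have "\<dots> \<le> Itilde \<alpha> 0 Z" using \<alpha> R by (intro Itilde_ge) auto
    finally show ?thesis
      using \<alpha> by (cases "Itilde \<alpha> 0 Z") (auto simp: pos_le_divide_eq mult.commute)
  qed
  have ev: "eventually (\<lambda>\<alpha>. 0 < \<alpha> \<and> \<alpha> < (1::real)) (at_left 1)"
    by (auto simp: eventually_at_left_field intro!: exI[of _ 0])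
  show ?thesis
  proof (rule order_tendstoI)
    fix a assume "a < ereal (measure lebesgue Z)"
    then obtain b where b: "a < ereal b" "b < measure lebesgue Z" using ereal_dense2 by fastforce
    then have "eventually (\<lambda>n. b < measure lebesgue (trunc (real n))) sequentially"
      using order_tendstoD(1)[OF tendsto_measure_trunc[OF fin]] by blast
    then obtain n where n: "b < measure lebesgue (trunc (real n))"
      by (auto simp: eventually_sequentially)
    let ?l = "\<lambda>\<alpha>. measure lebesgue (trunc (real n)) - (1 - \<alpha>) * (real n)\<^sup>2 / \<alpha>"
    have "(?l \<longlongrightarrow> measure lebesgue (trunc (real n)) - (1 - 1) * (real n)\<^sup>2 / 1) (at_left 1)"
      by (intro tendsto_intros) auto
    then have "eventually (\<lambda>\<alpha>. b < ?l \<alpha>) (at_left 1)" using n by (intro order_tendstoD(1)) auto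
    then show "eventually (\<lambda>\<alpha>. a < Itilde \<alpha> 0 Z / ereal (1 - \<alpha>)) (at_left 1)"
      using ev
    proof eventually_elim
      case (elim \<alpha>)
      then have "a < ereal (?l \<alpha>)" using b(1) by (meson less_ereal.simps(1) order.strict_trans)
      also have "\<dots> \<le> Itilde \<alpha> 0 Z / ereal (1 - \<alpha>)" using elim by (intro lower) auto
      finally show ?case .
    qed
  next
    fix a assume a: "ereal (measure lebesgue Z) < a"
    show "eventually (\<lambda>\<alpha>. Itilde \<alpha> 0 Z / ereal (1 - \<alpha>) < a) (at_left 1)"
      using ev by eventually_elim (use upper a in \<open>auto intro: order.strict_trans1\<close>)
  qed
qed

text \<open>The quotient is constant for \<open>\<alpha>\<close> between \<open>1/2\<close> and 1,
  including the case of infinite \<open>gamma_thin Z\<close>.\<close>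

lemma two_sided_limit:
  "((\<lambda>\<alpha>. Itilde \<alpha> \<alpha> Z / ereal (1 - \<alpha>)) \<longlongrightarrow> gamma_thin Z) (at_left 1)"
proof (rule tendsto_eventually)
  have "eventually (\<lambda>\<alpha>. 1 / 2 < \<alpha> \<and> \<alpha> < (1::real)) (at_left 1)"
    by (auto simp: eventually_at_left_field intro!: exI[of _ "1 / 2"])
  then show "eventually (\<lambda>\<alpha>. Itilde \<alpha> \<alpha> Z / ereal (1 - \<alpha>) = gamma_thin Z) (at_left 1)"
  proof eventually_elim
    case (elim \<alpha>)
    then have "Itilde \<alpha> \<alpha> Z = ereal (1 - \<alpha>) * gamma_thin Z" by (intro Itilde_eq_thin) auto
    then show ?case using elim by (cases "gamma_thin Z") auto
  qed
qed

end

section \<open>The extremal ratio, approached along L-shapes\<close>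

lemma Itilde_Lshape:
  assumes n: "1 \<le> n"
  shows "Itilde \<alpha> \<beta> (Lshape n) = ereal (I_bdd \<alpha> \<beta> (Lshape n))"
  unfolding Itilde_def
proof (intro tendsto_Lim tendsto_eventually)
  show "eventually (\<lambda>R. ereal (I_bdd \<alpha> \<beta> (Lshape n \<inter> {0..R} \<times> {0..R})) = ereal (I_bdd \<alpha> \<beta> (Lshape n))) at_top"
    using eventually_ge_at_top[of "real n"]
  proof eventually_elim
    case (elim R)
    then have "Lshape n \<inter> {0..R} \<times> {0..R} = Lshape n" using n by (auto simp: Lshape_def)
    then show ?case by simp
  qed
qed simp

text \<open>On long L-shapes the general bound \<open>T \<le> 2 * I\<close> is nearly an equality:
  \<open>I \<le> n\<close> and \<open>T \<ge> 2 * n - 2\<close> give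
  \<open>T \<ge> (2 - 2/n) * I\<close>. Inserting this into the mixed bound or the thin identity
  loses at most \<open>2/n\<close>.\<close>

lemma ratio_Lshape_ge:
  assumes n: "2 \<le> n" and \<alpha>: "0 \<le> \<alpha>" "\<alpha> \<le> 1"
  shows "ereal (min 1 (2 * (1 - \<alpha>)) - 2 / real n) \<le> Itilde \<alpha> \<alpha> (Lshape n) / gamma_tilde (Lshape n)"
proof -
  have L: "zero_region (real n) (Lshape n)" using n by (intro zero_region_Lshape) auto
  define I T where "I = I_bdd 0 0 (Lshape n)" and "T = gthin_bdd (Lshape n)"
  have T: "2 * real n - 2 \<le> T" "T \<le> 2 * I" and In: "I \<le> real n"
    unfolding I_def T_def
    using n gthin_bdd_Lshape_ge gthin_bdd_le_twice[OF L] I_bdd_Lshape_le by auto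
  \<comment> \<open>Here \<open>n \<ge> 2\<close> makes \<open>2 * n - 2\<close> at least 2, so the
    denominator of the ratio is positive.\<close>
  have "2 \<le> 2 * I" using T n by linarith
  then have I: "0 < I" by simp
  have "2 * real n - 2 = (2 - 2 / real n) * real n" using n by (simp add: field_simps)
  also have "\<dots> \<ge> (2 - 2 / real n) * I" using In n by (intro mult_left_mono) (auto simp: field_simps)
  finally have TI: "(2 - 2 / real n) * I \<le> T" using T by linarith
  have "(min 1 (2 * (1 - \<alpha>)) - 2 / real n) * I \<le> I_bdd \<alpha> \<alpha> (Lshape n)"
  proof (cases "\<alpha> \<le> 1 / 2")
    case True
    have "(1 - 2 / real n) * I \<le> (1 - \<alpha> * (2 / real n)) * I"
      using \<alpha> I n by (intro mult_right_mono) (auto simp: divide_simps)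
    also have "\<dots> = (1 - 2 * \<alpha>) * I + \<alpha> * ((2 - 2 / real n) * I)" by (simp add: algebra_simps)
    also have "\<dots> \<le> (1 - 2 * \<alpha>) * I + \<alpha> * T" using TI \<alpha> by (intro add_left_mono mult_left_mono) auto
    also have "\<dots> \<le> I_bdd \<alpha> \<alpha> (Lshape n)"
      unfolding I_def T_def using I_bdd_ge_mix[OF L \<alpha>(1) True] .
    finally show ?thesis using True by (simp add: min_def)
  next
    case False
    have "(2 * (1 - \<alpha>) - 2 / real n) * I \<le> (2 * (1 - \<alpha>) - (1 - \<alpha>) * (2 / real n)) * I"
      using \<alpha> I n by (intro mult_right_mono) (auto simp: divide_simps algebra_simps)
    also have "\<dots> = (1 - \<alpha>) * ((2 - 2 / real n) * I)" by (simp add: algebra_simps)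
    also have "\<dots> \<le> (1 - \<alpha>) * T" using TI \<alpha> by (intro mult_left_mono) auto
    also have "\<dots> = I_bdd \<alpha> \<alpha> (Lshape n)"
      unfolding T_def using I_bdd_eq_thin[OF L, of \<alpha>] False \<alpha> by simp
    finally show ?thesis using False by (simp add: min_def)
  qed
  then have "min 1 (2 * (1 - \<alpha>)) - 2 / real n \<le> I_bdd \<alpha> \<alpha> (Lshape n) / I"
    using I by (simp add: pos_le_divide_eq)
  then show ?thesis
    using n I by (simp add: gamma_tilde_def Itilde_Lshape I_def)
qed

abbreviation (input) positive_zero_sets :: "(real \<times> real) set set" where
  "positive_zero_sets \<equiv> {Z. euclid_zero_set Z \<and> 0 < emeasure lebesgue Z \<and> emeasure lebesgue Z < \<infinity>}"

lemma Lshape_in_positive_zero_sets: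
  assumes n: "1 \<le> n"
  shows "Lshape n \<in> positive_zero_sets"
proof -
  have c: "compact (Lshape n)" using zero_regionD(5)[OF zero_region_Lshape[OF n]] .
  have "cbox (0, 0) (1, 1) \<subseteq> Lshape n" using n by (auto simp: Lshape_def cbox_Pair_eq)
  then have "measure lebesgue (cbox (0::real, 0::real) (1, 1)) \<le> measure lebesgue (Lshape n)"
    using c by (intro measure_mono_fmeasurable) (auto simp: lmeasurable_compact)
  then have "0 < measure lebesgue (Lshape n)" by (simp add: content_Pair)
  then have "0 < emeasure lebesgue (Lshape n)"
    by (metis enn2real_0 measure_def not_gr_zero order_less_irrefl)
  moreover have "emeasure lebesgue (Lshape n) < \<infinity>"
    using lmeasurable_compact[OF c] unfolding fmeasurable_def by blast
  ultimately show ?thesis using euclid_zero_set_Lshape[OF n] by simp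
qed

lemma SUP_ratio:
  assumes \<alpha>: "0 \<le> \<alpha>" "\<alpha> \<le> 1"
  shows "(SUP Z\<in>positive_zero_sets. Itilde \<alpha> \<alpha> Z / gamma_tilde Z) = ereal (min 1 (2 * (1 - \<alpha>)))"
proof (rule antisym)
  show "(SUP Z\<in>positive_zero_sets. Itilde \<alpha> \<alpha> Z / gamma_tilde Z) \<le> ereal (min 1 (2 * (1 - \<alpha>)))"
  proof (rule SUP_least)
    fix Z assume "Z \<in> positive_zero_sets"
    then have Z: "euclid_zero_set Z" by simp
    show "Itilde \<alpha> \<alpha> Z / gamma_tilde Z \<le> ereal (min 1 (2 * (1 - \<alpha>)))"
    proof (rule Itilde_le_mult_gamma[OF Z \<alpha>])
      fix R :: real assume "0 \<le> R"
      note zr = zero_region_truncate[OF Z this]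
      show "I_bdd \<alpha> \<alpha> (Z \<inter> {0..R} \<times> {0..R}) \<le> min 1 (2 * (1 - \<alpha>)) * I_bdd 0 0 (Z \<inter> {0..R} \<times> {0..R})"
      proof (cases "\<alpha> \<le> 1 / 2")
        case True
        then show ?thesis using I_bdd_le_zero[OF zr \<alpha>] by (simp add: min_def)
      next
        case False
        have "(1 - \<alpha>) * gthin_bdd (Z \<inter> {0..R} \<times> {0..R}) \<le> (1 - \<alpha>) * (2 * I_bdd 0 0 (Z \<inter> {0..R} \<times> {0..R}))"
          using gthin_bdd_le_twice[OF zr] \<alpha> by (intro mult_left_mono) auto
        then show ?thesis using I_bdd_eq_thin[OF zr, of \<alpha>] False \<alpha> by (simp add: min_def algebra_simps)
      qed
    qed (use \<alpha> in auto)
  qed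
  have "(\<lambda>n. ereal (min 1 (2 * (1 - \<alpha>)) - 2 / real n)) \<longlonglongrightarrow> ereal (min 1 (2 * (1 - \<alpha>)) - 0)"
    by (intro tendsto_intros lim_const_over_n)
  then have lim: "(\<lambda>n. ereal (min 1 (2 * (1 - \<alpha>)) - 2 / real n)) \<longlonglongrightarrow> ereal (min 1 (2 * (1 - \<alpha>)))"
    by simp
  have "eventually (\<lambda>n. ereal (min 1 (2 * (1 - \<alpha>)) - 2 / real n)
      \<le> (SUP Z\<in>positive_zero_sets. Itilde \<alpha> \<alpha> Z / gamma_tilde Z)) sequentially"
    using eventually_ge_at_top[of 2]
  proof eventually_elim
    case (elim n)
    then have "Lshape n \<in> positive_zero_sets" by (intro Lshape_in_positive_zero_sets) simp
    then show ?case using SUP_upper[where f = "\<lambda>Z. Itilde \<alpha> \<alpha> Z / gamma_tilde Z"]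
      by (intro order.trans[OF ratio_Lshape_ge[OF elim \<alpha>]])
  qed
  then show "ereal (min 1 (2 * (1 - \<alpha>))) \<le> (SUP Z\<in>positive_zero_sets. Itilde \<alpha> \<alpha> Z / gamma_tilde Z)"
    by (rule tendsto_upperbound[OF lim]) simp
qed

theorem mainTheorem6:
  shows "(\<forall>Z. euclid_zero_set Z \<and> emeasure lebesgue Z < \<infinity> \<longrightarrow>
            ((\<lambda>\<alpha>. Itilde \<alpha> 0 Z / ereal (1 - \<alpha>)) \<longlongrightarrow> ereal (measure lebesgue Z)) (at_left 1) \<and>
            ((\<lambda>\<alpha>. Itilde \<alpha> \<alpha> Z / ereal (1 - \<alpha>)) \<longlongrightarrow> gamma_thin Z) (at_left 1))
     \<and> ((\<lambda>\<alpha>. ((SUP Z\<in>{Z. euclid_zero_set Z \<and> 0 < emeasure lebesgue Z \<and> emeasure lebesgue Z < \<infinity>}.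
                  Itilde \<alpha> \<alpha> Z / gamma_tilde Z) - 1) / ereal \<alpha>) \<longlongrightarrow> 0) (at_right 0)
     \<and> ((\<lambda>\<alpha>. ((SUP Z\<in>{Z. euclid_zero_set Z \<and> 0 < emeasure lebesgue Z \<and> emeasure lebesgue Z < \<infinity>}.
                  Itilde \<alpha> \<alpha> Z / gamma_tilde Z) - ereal (2 * (1 - \<alpha>))) / ereal (1 - \<alpha>)) \<longlongrightarrow> 0) (at_left 1)"
proof (intro conjI allI impI)
  fix Z assume "euclid_zero_set Z \<and> emeasure lebesgue Z < \<infinity>"
  then show "((\<lambda>\<alpha>. Itilde \<alpha> 0 Z / ereal (1 - \<alpha>)) \<longlongrightarrow> ereal (measure lebesgue Z)) (at_left 1)"
    "((\<lambda>\<alpha>. Itilde \<alpha> \<alpha> Z / ereal (1 - \<alpha>)) \<longlongrightarrow> gamma_thin Z) (at_left 1)"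
    by (simp_all add: one_sided_limit two_sided_limit)
next
  \<comment> \<open>Near each end point one branch of the minimum is active, so the error terms are
    identically 0 there.\<close>
  have "eventually (\<lambda>\<alpha>::real. 0 < \<alpha> \<and> \<alpha> < 1 / 2) (at_right 0)"
    by (auto simp: eventually_at_right_field intro!: exI[of _ "1 / 2"])
  then show "((\<lambda>\<alpha>. ((SUP Z\<in>positive_zero_sets. Itilde \<alpha> \<alpha> Z / gamma_tilde Z) - 1) / ereal \<alpha>) \<longlongrightarrow> 0) (at_right 0)"
    by (intro tendsto_eventually, eventually_elim) (subst SUP_ratio, auto simp: one_ereal_def)
next
  have "eventually (\<lambda>\<alpha>::real. 1 / 2 < \<alpha> \<and> \<alpha> < 1) (at_left 1)"
    by (auto simp: eventually_at_left_field intro!: exI[of _ "1 / 2"])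
  then show "((\<lambda>\<alpha>. ((SUP Z\<in>positive_zero_sets. Itilde \<alpha> \<alpha> Z / gamma_tilde Z) - ereal (2 * (1 - \<alpha>))) / ereal (1 - \<alpha>)) \<longlongrightarrow> 0) (at_left 1)"
    by (intro tendsto_eventually, eventually_elim) (subst SUP_ratio, auto)
qed

end
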